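(* Let $G$ be a finite abelian group of rank $r\in \mathbb N_+$ and exponent $m\in \mathbb N_{\geq 2}$ which is not a group of prime power order. Then $$\mathsf D(G) \ge \mathsf D^*(G) + \max\left\{ \log_2 \log \frac{m^r}{|G|}- 2\log_2 \log \frac{m}{2}-m+\log_2\log 2+1,\ 0\right\},$$ where, in the case $|G|=m^r$, the convention $\log_2(0)=-\infty$ is used.
   Context: $\log$ is the natural logarithm and $\log_2$ the logarithm to base $2$. $C_n$ denotes the cyclic group of order $n$, written additively. Every nontrivial finite abelian group can be written uniquely as $G\cong C_{n_1}\oplus\dots\oplus C_{n_r}$ with $1<n_1\mid\dots\mid n_r$; then $r$ is the rank of $G$, $n_r$ is its exponent, and $\mathsf D^*(G)=1+\sum_{i=1}^r(n_i-1)$. A sequence over $G$ is a finite unordered sequence (multiset) of elements of $G$, repetition allowed; it is zero-sum if its terms sum to $0$. The Davenport constant $\mathsf D(G)$ is the smallest integer $d$ such that every sequence over $G$ of length at least $d$ (counted with multiplicity) has a nonempty zero-sum subsequence. *)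

theory Defs
  imports
    "HOL-Algebra.Algebra"
    "HOL-Number_Theory.Prime_Powers"
    "HOL-Library.Multiset"
    "HOL-Library.Extended_Real"
begin

text \<open>
  Finite abelian groups are the commutative groups of HOL-Algebra, which are written
  multiplicatively; \<^const>\<open>integer_mod_group\<close> is the (additive) cyclic group of residues.
\<close>

definition is_invariant_factors :: "('a, 'b) monoid_scheme \<Rightarrow> nat list \<Rightarrow> bool" where
  "is_invariant_factors G ns \<longleftrightarrow>
     (\<forall>n \<in> set ns. 1 < n) \<and> sorted_wrt (dvd) ns \<and>
     G \<cong> product_group {..<length ns} (\<lambda>i. integer_mod_group (ns ! i))"

text \<open>
  For a finite abelian group the list exists and is unique; the trivial group has the empty list.
\<close>

definition invariant_factors :: "('a, 'b) monoid_scheme \<Rightarrow> nat list" where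
  "invariant_factors G = (SOME ns. is_invariant_factors G ns)"

definition group_rank :: "('a, 'b) monoid_scheme \<Rightarrow> nat" where
  "group_rank G = length (invariant_factors G)"

text \<open>Meaningful for nontrivial groups only, where the list is nonempty.\<close>

definition group_exponent :: "('a, 'b) monoid_scheme \<Rightarrow> nat" where
  "group_exponent G = last (invariant_factors G)"

definition davenport_star :: "('a, 'b) monoid_scheme \<Rightarrow> nat" where
  "davenport_star G = 1 + (\<Sum>n\<leftarrow>invariant_factors G. n - 1)"

definition seq_over :: "('a, 'b) monoid_scheme \<Rightarrow> 'a multiset \<Rightarrow> bool" where
  "seq_over G S \<longleftrightarrow> set_mset S \<subseteq> carrier G"

text \<open>
  The sum of the terms of \<open>S\<close>, grouped by the distinct elements \<open>g\<close> occurring in \<open>S\<close>.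
\<close>

definition seq_sum :: "('a, 'b) monoid_scheme \<Rightarrow> 'a multiset \<Rightarrow> 'a" where
  "seq_sum G S = (\<Otimes>\<^bsub>G\<^esub>g \<in> set_mset S. g [^]\<^bsub>G\<^esub> count S g)"

definition zero_sum :: "('a, 'b) monoid_scheme \<Rightarrow> 'a multiset \<Rightarrow> bool" where
  "zero_sum G S \<longleftrightarrow> seq_sum G S = \<one>\<^bsub>G\<^esub>"

definition davenport :: "('a, 'b) monoid_scheme \<Rightarrow> nat" where
  "davenport G = (LEAST d. \<forall>S. seq_over G S \<and> d \<le> size S \<longrightarrow>
                             (\<exists>T. T \<subseteq># S \<and> T \<noteq> {#} \<and> zero_sum G T))"

text \<open>
  Binary logarithm on the nonnegative reals with the convention that its value at 0 is
  \<open>- \<infinity>\<close>; the library's \<^term>\<open>log 2 0\<close> is \<open>0\<close>.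
\<close>

definition elog2 :: "real \<Rightarrow> ereal" where
  "elog2 x = (if x = 0 then - \<infinity> else ereal (log 2 x))"

end

theory Submission
  imports Defs
begin

text \<open>
  Let \<open>n \<noteq> m\<close> be an invariant factor of multiplicity at least \<open>2\<^sup>t\<^sup>-\<^sup>1\<close>. As \<open>m\<close> is not a prime power, there
  are distinct primes \<open>p\<close> dividing \<open>m / n\<close> and \<open>l\<close> dividing \<open>n\<close>. Start from the zero-sum free
  sequence in which every basis element \<open>e\<^sub>i\<close> occurs \<open>n\<^sub>i - 1\<close> times, replace the \<open>m - 1\<close> copies of
  the last basis element \<open>u\<close> by \<open>t\<close> elements whose \<open>e\<^sub>i\<close>-coordinates lie in the subgroup of order
  \<open>l\<close>, and shift some \<open>e\<^sub>i\<close> by a multiple of \<open>u\<close>. In a zero-sum subsequence the chosen new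
  elements determine the multiplicities of the \<open>e\<^sub>i\<close> as residues modulo \<open>l\<close> of linear forms, and the
  \<open>p\<close>-part of the \<open>u\<close>-coordinate is the sum of these residues. The forms run through
  representatives of a projective space over \<open>\<int>/l\<close> and their negatives, which makes this sum a
  power of \<open>l\<close>, hence prime to \<open>p\<close>, as soon as some new element is chosen. This gives
  \<open>D(G) \<ge> D\<^sup>*(G) + t - m + 1\<close>.

  Proper invariant factors form a divisor chain of at most \<open>log\<^sub>2 (m / 2)\<close> values, each contributing at
  most \<open>log (m / 2)\<close> per occurrence to \<open>log (m\<^sup>r / |G|)\<close>; so some value occurs often enough.
\<close>

subsection \<open>Invariant factors of finite abelian groups\<close>

lemma (in comm_group) ord_mult_coprime:
  assumes x: "x \<in> carrier G" and y: "y \<in> carrier G" and cop: "coprime (ord x) (ord y)"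
  shows "ord (x \<otimes> y) = ord x * ord y"
proof (rule dvd_antisym)
  show "ord (x \<otimes> y) dvd ord x * ord y"
    by (rule abelian_ord_mul_divides[OF x y])
  define N where "N = ord (x \<otimes> y)"
  \<comment> \<open>Raising to the power \<open>ord b\<close> eliminates \<open>b\<close>;
    coprimality then removes \<open>ord b\<close> from the exponent
    \<open>N * ord b\<close>.\<close>
  have key: "ord a dvd N"
    if a: "a \<in> carrier G" and b: "b \<in> carrier G" and "coprime (ord a) (ord b)"
      and ab: "(a \<otimes> b) [^] N = \<one>" for a b
  proof -
    have "(a \<otimes> b) [^] (N * ord b) = \<one>"
      using a b ab by (metis m_closed nat_pow_one nat_pow_pow)
    moreover have "b [^] (N * ord b) = \<one>"
      using b by (simp add: pow_eq_id)
    ultimately have "a [^] (N * ord b) = \<one>"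
      using a b by (simp add: nat_pow_distrib)
    then show ?thesis
      using a that(3) by (simp add: pow_eq_id coprime_dvd_mult_left_iff)
  qed
  have 1: "(x \<otimes> y) [^] N = \<one>"
    using x y by (simp add: N_def)
  then have "ord x dvd N" "ord y dvd N"
    using key[OF x y cop] key[OF y x] x y cop by (auto simp: m_comm coprime_commute)
  then show "ord x * ord y dvd ord (x \<otimes> y)"
    using cop by (simp add: N_def divides_mult)
qed

text \<open>An element of maximal order works: if some \<open>ord x\<close> had a higher power
  \<open>p^a\<close> of a prime than \<open>ord g\<close>, then \<open>p^a\<close> times the
  \<open>p\<close>-free part of \<open>ord g\<close> would be the order of a product of powers of
  \<open>x\<close> and \<open>g\<close>.\<close>

lemma (in comm_group) max_ord_is_exponent:
  assumes fin: "finite (carrier G)"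
  obtains g where "g \<in> carrier G" and "\<And>x. x \<in> carrier G \<Longrightarrow> x [^] ord g = \<one>"
proof -
  define M where "M = Max (ord ` carrier G)"
  have "M \<in> ord ` carrier G"
    unfolding M_def using fin by (intro Max_in) auto
  then obtain g where g: "g \<in> carrier G" "ord g = M" by auto
  have le: "ord x \<le> M" if "x \<in> carrier G" for x
    unfolding M_def using fin that by auto
  have pos: "ord x > 0" if "x \<in> carrier G" for x
    using ord_ge_1[OF fin that] by simp
  have "x [^] ord g = \<one>" if x: "x \<in> carrier G" for x
  proof (rule ccontr)
    assume "x [^] ord g \<noteq> \<one>"
    then have "\<not> ord x dvd ord g" using x by (simp add: pow_eq_id)
    then have "\<not> (\<forall>p. Factorial_Ring.prime p \<longrightarrow> multiplicity p (ord x) \<le> multiplicity p (ord g))"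
      using multiplicity_le_imp_dvd[of "ord x" "ord g"] pos[OF x] by blast
    then obtain p where p: "Factorial_Ring.prime p" and lt: "multiplicity p (ord g) < multiplicity p (ord x)"
      using not_le by blast
    define a b where "a = multiplicity p (ord x)" and "b = multiplicity p (ord g)"
    obtain u where u: "ord x = p ^ a * u" "\<not> p dvd u"
      using multiplicity_decompose'[of "ord x" p] pos[OF x] p not_prime_unit[of p] unfolding a_def
      by blast
    obtain v where v: "ord g = p ^ b * v" "\<not> p dvd v"
      using multiplicity_decompose'[of "ord g" p] pos[OF g(1)] p not_prime_unit[of p] unfolding b_def
      by blast
    have p0: "p > 0" using p prime_gt_0_nat by blast
    have u0: "u > 0" using u(2) by (cases "u = 0") auto
    have 1: "ord (x [^] u) = p ^ a"
      using ord_pow[OF x, of u] u0 unfolding u(1) by simp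
    have 2: "ord (g [^] (p ^ b)) = v"
      using ord_pow[OF g(1), of "p ^ b"] p0 unfolding v(1) by simp
    have "coprime (p ^ a) v"
      using v p by (simp add: prime_imp_coprime coprime_power_left_iff)
    then have "ord (x [^] u \<otimes> g [^] (p ^ b)) = p ^ a * v"
      using ord_mult_coprime[of "x [^] u" "g [^] (p ^ b)"] 1 2 x g by simp
    then have "p ^ a * v \<le> p ^ b * v"
      using le[of "x [^] u \<otimes> g [^] (p ^ b)"] x g v by simp
    moreover have "v > 0" using v(2) by (cases "v = 0") auto
    ultimately have "p ^ a \<le> p ^ b" by simp
    then show False
      using power_strict_increasing[of b a p] lt prime_gt_1_nat[OF p]
      unfolding a_def[symmetric] b_def[symmetric] by linarith
  qed
  with g(1) show thesis using that by blast
qed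

lemma (in group) subgroup_nat_pow_closed:
  assumes "subgroup K G" "x \<in> K"
  shows "x [^] (n :: nat) \<in> K"
  using subgroup_int_pow_closed[OF assms, of "int n"] by (simp add: int_pow_int)

text \<open>The exponents that send \<open>x\<close> into \<open>K\<close> form an ideal of the
  integers containing the prime \<open>p\<close> but not 1, so it is generated by
  \<open>p\<close>.\<close>

lemma (in group) dvd_of_pow_in_subgroup:
  fixes p b :: nat
  assumes K: "subgroup K G" and x: "x \<in> carrier G" and p: "Factorial_Ring.prime p"
    and "x [^] p \<in> K" "x [^] b \<in> K" "x \<notin> K"
  shows "p dvd b"
proof (rule ccontr)
  assume "\<not> p dvd b"
  with p have "coprime (int p) (int b)"
    by (simp add: prime_imp_coprime)
  then obtain u v where uv: "u * int p + v * int b = 1"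
    using bezout_int[of "int p" "int b"] by auto
  have "(x [^] p) [^] u \<in> K" "(x [^] b) [^] v \<in> K"
    using assms by (auto intro: subgroup_int_pow_closed)
  moreover have "(x [^] p) [^] u \<otimes> (x [^] b) [^] v = x"
  proof -
    have "(x [^] p) [^] u = x [^] (int p * u)" "(x [^] b) [^] v = x [^] (int b * v)"
      using int_pow_pow[OF x] by (metis int_pow_int)+
    then show ?thesis
      using int_pow_mult[OF x, of "int p * u" "int b * v"] x uv by (simp add: mult.commute)
  qed
  ultimately show False
    using assms(6) subgroup.m_closed[OF K] by metis
qed

text \<open>
  Take \<open>H\<close> maximal among the subgroups meeting \<open>\<langle>g\<rangle>\<close> trivially. If some \<open>x\<close> lies outside
  \<open>H\<langle>g\<rangle>\<close> but \<open>x\<^sup>p\<close> inside, the exponent condition allows changing \<open>x\<close> by a power of \<open>g\<close> so that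
  \<open>x\<^sup>p \<in> H\<close>; then adjoining \<open>x\<close> to \<open>H\<close> contradicts maximality.
\<close>

lemma (in comm_group) cyclic_subgroup_complement:
  assumes fin: "finite (carrier G)" and g: "g \<in> carrier G"
    and expo: "\<And>x. x \<in> carrier G \<Longrightarrow> x [^] ord g = \<one>"
  obtains H where "subgroup H G" and "H \<inter> generate G {g} = {\<one>}"
    and "H <#> generate G {g} = carrier G"
proof -
  define C where "C = generate G {g}"
  have C: "subgroup C G"
    unfolding C_def using g by (intro generate_is_subgroup) auto
  have C_eq: "C = {g [^] k |k. k \<in> (UNIV :: nat set)}"
    unfolding C_def using generate_pow_on_finite_carrier[OF fin g] by blast
  define \<H> where "\<H> = {H. subgroup H G \<and> H \<inter> C = {\<one>}}"
  have "\<H> \<subseteq> Pow (carrier G)"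
    unfolding \<H>_def using subgroup.subset by auto
  then have "finite \<H>" using fin by (meson finite_Pow_iff finite_subset)
  moreover have "{\<one>} \<in> \<H>"
    unfolding \<H>_def using triv_subgroup subgroup.one_closed[OF C] by auto
  ultimately have "Max (card ` \<H>) \<in> card ` \<H>" and le_Max: "\<And>K. K \<in> \<H> \<Longrightarrow> card K \<le> Max (card ` \<H>)"
    by (auto intro!: Max_in)
  then obtain H where H: "H \<in> \<H>" and Hmax: "\<And>K. K \<in> \<H> \<Longrightarrow> card K \<le> card H"
    by auto
  have sub: "subgroup H G" and HC: "H \<inter> C = {\<one>}" using H by (auto simp: \<H>_def)
  define K where "K = H <#> C"
  have K: "subgroup K G" unfolding K_def using mult_subgroups[OF sub C] .
  have HK: "h \<in> K" if "h \<in> H" for h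
    unfolding K_def set_mult_def using that subgroup.one_closed[OF C] subgroup.mem_carrier[OF sub that]
    by force
  have CK: "c \<in> K" if "c \<in> C" for c
    unfolding K_def set_mult_def using that subgroup.one_closed[OF sub] subgroup.mem_carrier[OF C that]
    by force
  have "K = carrier G"
  proof (rule ccontr)
    assume "K \<noteq> carrier G"
    then obtain x0 where x0: "x0 \<in> carrier G" "x0 \<notin> K"
      using subgroup.subset[OF K] by blast
    have ord0: "ord g > 0" using ord_ge_1[OF fin g] by simp
    have ex: "\<exists>j. 0 < j \<and> x0 [^] (j::nat) \<in> K"
      using ord0 expo[OF x0(1)] subgroup.one_closed[OF K] by metis
    \<comment> \<open>Dividing the least exponent \<open>j\<close> by a prime \<open>p\<close> gives
      \<open>x = x0^(j/p)\<close> outside \<open>K\<close> whose \<open>p\<close>-th power is in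
      \<open>K\<close>.\<close>
    define j where "j = (LEAST j. 0 < j \<and> x0 [^] (j::nat) \<in> K)"
    have j: "0 < j" "x0 [^] j \<in> K"
      using LeastI_ex[OF ex] by (auto simp: j_def)
    have jmin: "j \<le> i" if "0 < i" "x0 [^] i \<in> K" for i
      unfolding j_def using that by (intro Least_le) auto
    have "j \<noteq> 1" using j x0 by auto
    then obtain p where p: "Factorial_Ring.prime p" "p dvd j" using prime_factor_nat by blast
    then obtain q where q: "j = p * q" by auto
    have q0: "q > 0" "q < j" using q j prime_gt_1_nat[OF p(1)] by auto
    define x where "x = x0 [^] q"
    have x: "x \<in> carrier G" "x \<notin> K"
      using x0 q0 jmin[of q] by (auto simp: x_def)
    have xp: "x [^] p \<in> K"
      using j q x0 by (simp add: x_def nat_pow_pow mult.commute)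
    have "x [^] ord g \<in> K"
      using expo[OF x(1)] subgroup.one_closed[OF K] by simp
    then have "p dvd ord g"
      using dvd_of_pow_in_subgroup[OF K x(1) p(1) xp] x by blast
    then obtain m' where m': "ord g = p * m'" by auto
    obtain h a where h: "h \<in> H" and xpe: "x [^] p = h \<otimes> g [^] (a::nat)"
      using xp unfolding K_def set_mult_def C_eq by auto
    have hc: "h \<in> carrier G" using h subgroup.mem_carrier[OF sub] by blast
    \<comment> \<open>As \<open>H\<close> and \<open>C\<close> meet trivially, the
      \<open>g\<close>-part of this trivial product is trivial by itself, which forces
      \<open>p\<close> to divide \<open>a\<close>.\<close>
    have "\<one> = (x [^] p) [^] m'"
      using expo[OF x(1)] x by (simp add: m' nat_pow_pow)
    also have "\<dots> = h [^] m' \<otimes> g [^] (a * m')"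
      using hc g by (simp add: xpe nat_pow_distrib nat_pow_pow)
    finally have 1: "\<one> = h [^] m' \<otimes> g [^] (a * m')" .
    then have "g [^] (a * m') = inv (h [^] m')"
      using hc g by (metis inv_equality inv_inv nat_pow_closed)
    moreover have "inv (h [^] m') \<in> H"
      using h sub by (simp add: subgroup.m_inv_closed subgroup_nat_pow_closed)
    moreover have "g [^] (a * m') \<in> C" unfolding C_eq by blast
    ultimately have "g [^] (a * m') = \<one>" using HC by auto
    then have "ord g dvd a * m'" using g by (simp add: pow_eq_id)
    then have "p dvd a" using m' ord0 by simp
    then obtain a' where a': "a = p * a'" by auto
    define y where "y = x \<otimes> inv (g [^] a')"
    have y: "y \<in> carrier G" using x g by (simp add: y_def)
    have gaC: "g [^] a' \<in> C" unfolding C_eq by blast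
    have xy: "x = y \<otimes> g [^] a'" using x g by (simp add: y_def m_assoc)
    then have yK: "y \<notin> K"
      using x CK[OF gaC] subgroup.m_closed[OF K] by metis
    have "y [^] p \<otimes> g [^] a = h \<otimes> g [^] a"
      using xpe y g by (simp add: xy nat_pow_distrib nat_pow_pow a' mult.commute)
    then have yp: "y [^] p = h" using y g hc by simp
    define H' where "H' = H <#> generate G {y}"
    have gy: "subgroup (generate G {y}) G"
      using y by (intro generate_is_subgroup) auto
    have gy_eq: "generate G {y} = {y [^] k |k. k \<in> (UNIV :: nat set)}"
      using generate_pow_on_finite_carrier[OF fin y] by blast
    have sub': "subgroup H' G" unfolding H'_def using mult_subgroups[OF sub gy] .
    have "H \<subseteq> H'"
    proof
      fix z assume "z \<in> H"
      then show "z \<in> H'"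
        unfolding H'_def set_mult_def
        using subgroup.one_closed[OF gy] subgroup.mem_carrier[OF sub] by force
    qed
    moreover have "y \<in> H'"
    proof -
      have "\<one> \<otimes> y \<in> H'"
        unfolding H'_def set_mult_def
        using subgroup.one_closed[OF sub] generate.incl[of y "{y}" G] by blast
      then show ?thesis using y by simp
    qed
    moreover have "y \<notin> H" using HK yK by blast
    ultimately have "H \<subset> H'" by blast
    moreover have "finite H'" using sub' fin subgroup.subset finite_subset by metis
    ultimately have "card H < card H'" by (rule psubset_card_mono[rotated])
    then have "H' \<notin> \<H>" using Hmax by fastforce
    then have "H' \<inter> C \<noteq> {\<one>}" using sub' by (auto simp: \<H>_def)
    then obtain w where w: "w \<in> H'" "w \<in> C" "w \<noteq> \<one>"
      using subgroup.one_closed[OF sub'] subgroup.one_closed[OF C] by blast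
    \<comment> \<open>Since \<open>y^b\<close> lies in \<open>K\<close> and \<open>y\<close> does
      not, \<open>p\<close> divides \<open>b\<close>; so \<open>y^b\<close> is a power of
      \<open>h\<close> and \<open>w\<close> is already in \<open>H\<close>.\<close>
    obtain h1 b where h1: "h1 \<in> H" "w = h1 \<otimes> y [^] (b :: nat)"
      using w(1) unfolding H'_def set_mult_def gy_eq by auto
    have h1c: "h1 \<in> carrier G" using h1 subgroup.mem_carrier[OF sub] by blast
    have "y [^] b = inv h1 \<otimes> w"
      using h1 h1c y by (simp add: m_assoc[symmetric])
    then have "y [^] b \<in> K"
      using subgroup.m_closed[OF K HK CK] subgroup.m_inv_closed[OF sub] h1(1) w(2) by simp
    then have "p dvd b"
      using dvd_of_pow_in_subgroup[OF K y p(1), of b] yp HK[OF h] yK by blast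
    then obtain b' where "b = p * b'" by auto
    then have "y [^] b = h [^] b'" using y yp by (simp add: nat_pow_pow[symmetric])
    then have "w \<in> H"
      using h1 h sub by (simp add: subgroup.m_closed subgroup_nat_pow_closed)
    then show False using w HC by blast
  qed
  then show thesis using that sub HC unfolding K_def C_def by blast
qed

lemma product_group_component_hom:
  assumes "i \<in> I"
  shows "(\<lambda>x. x i) \<in> hom (product_group I A) (A i)"
  using assms by (auto simp: hom_def)

lemma invariant_factor_dvd_exponent:
  assumes iso: "G \<cong> product_group {..<length ns} (\<lambda>i. integer_mod_group (ns ! i))"
    and G: "group G" and gt: "\<forall>n\<in>set ns. 1 < n"
    and expo: "\<And>x. x \<in> carrier G \<Longrightarrow> x [^]\<^bsub>G\<^esub> m = \<one>\<^bsub>G\<^esub>" and n: "n \<in> set ns"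
  shows "n dvd m"
proof -
  define P where "P = product_group {..<length ns} (\<lambda>i. integer_mod_group (ns ! i))"
  have P: "group P" by (simp add: P_def)
  obtain i where i: "i < length ns" "ns ! i = n" using n by (auto simp: in_set_conv_nth)
  have n1: "n > 1" using gt n by blast
  \<comment> \<open>The exponent condition for the all-ones vector, read in component
    \<open>i\<close>, says that \<open>m\<close> is 0 modulo \<open>n\<close>.\<close>
  define v :: "nat \<Rightarrow> int" where "v = (\<lambda>j\<in>{..<length ns}. 1)"
  have v: "v \<in> carrier P"
    using gt by (auto simp: P_def v_def carrier_integer_mod_group)
  have "P \<cong> G" using iso G P group.iso_sym unfolding P_def by blast
  then obtain \<phi> where \<phi>: "\<phi> \<in> iso P G" by (auto simp: is_iso_def)
  then interpret \<phi>: group_hom P G \<phi>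
    using P G by (simp add: group_hom_def group_hom_axioms_def iso_def)
  have "\<phi> (v [^]\<^bsub>P\<^esub> m) = \<phi> \<one>\<^bsub>P\<^esub>"
    using v expo by (simp add: \<phi>.hom_nat_pow)
  moreover have "inj_on \<phi> (carrier P)" using \<phi> by (simp add: iso_def bij_betw_def)
  ultimately have "v [^]\<^bsub>P\<^esub> m = \<one>\<^bsub>P\<^esub>"
    using v \<phi>.G.nat_pow_closed \<phi>.G.one_closed by (meson inj_onD)
  then have "(v [^]\<^bsub>P\<^esub> m) i = \<one>\<^bsub>P\<^esub> i" by simp
  moreover have "(v [^]\<^bsub>P\<^esub> m) i = v i [^]\<^bsub>integer_mod_group n\<^esub> m"
  proof -
    have "(\<lambda>x. x i) \<in> hom P (integer_mod_group n)"
      using product_group_component_hom[of i "{..<length ns}"] i unfolding P_def by fastforce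
    then show ?thesis
      using hom_nat_pow[of "\<lambda>x. x i" P "integer_mod_group n" v m] v P by simp
  qed
  ultimately have "int m mod int n = 0"
    using i by (simp add: P_def v_def)
  then show ?thesis by (simp add: of_nat_mod[symmetric] mod_eq_0_iff_dvd)
qed

text \<open>The first coordinates are mapped into \<open>H\<close> and the last one is the exponent
  of \<open>g\<close>. Trivial intersection gives injectivity, the full product gives
  surjectivity.\<close>

lemma (in comm_group) iso_product_group_snoc:
  assumes H: "subgroup H G" and g: "g \<in> carrier G" and fin: "finite (carrier G)"
    and HC: "H \<inter> generate G {g} = {\<one>}"
    and full: "H <#> generate G {g} = carrier G"
    and iso: "G\<lparr>carrier := H\<rparr> \<cong> product_group {..<length ns} (\<lambda>i. integer_mod_group (ns ! i))"
  shows "G \<cong> product_group {..<length (ns @ [ord g])} (\<lambda>i. integer_mod_group ((ns @ [ord g]) ! i))"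
proof -
  define l where "l = length ns"
  define P where "P = product_group {..<l} (\<lambda>i. integer_mod_group (ns ! i))"
  define Q where "Q = product_group {..<Suc l} (\<lambda>i. integer_mod_group ((ns @ [ord g]) ! i))"
  have P: "group P" and Q: "group Q" by (simp_all add: P_def Q_def)
  have HG: "group (G\<lparr>carrier := H\<rparr>)" using H subgroup_imp_group by blast
  have m0: "ord g > 0" using ord_ge_1[OF fin g] by simp
  have C: "subgroup (generate G {g}) G"
    using g by (intro generate_is_subgroup) auto
  have "P \<cong> G\<lparr>carrier := H\<rparr>" using iso HG P group.iso_sym unfolding P_def l_def by blast
  then obtain \<phi> where \<phi>: "\<phi> \<in> iso P (G\<lparr>carrier := H\<rparr>)" by (auto simp: is_iso_def)
  have \<phi>H: "\<phi> v \<in> H" if "v \<in> carrier P" for v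
    using \<phi> that by (auto simp: iso_def hom_def)
  have HcG: "h \<in> carrier G" if "h \<in> H" for h using subgroup.mem_carrier[OF H that] .
  have \<phi>m: "\<phi> (v \<otimes>\<^bsub>P\<^esub> w) = \<phi> v \<otimes> \<phi> w" if "v \<in> carrier P" "w \<in> carrier P" for v w
    using \<phi> that by (auto simp: iso_def hom_def)
  interpret D: group_disjoint_sum G H "generate G {g}"
    using H C by (simp add: group_disjoint_sum_def)
  have cancel: "h = h' \<and> c = c'"
    if "h \<in> H" "h' \<in> H" "c \<in> generate G {g}" "c' \<in> generate G {g}" "h \<otimes> c = h' \<otimes> c'" for h h' c c'
    using D.cancel HC that by (metis order_refl)
  have powC: "g [^] (k::int) \<in> generate G {g}" for k
    unfolding generate_pow[OF g] by blast
  define \<psi> where "\<psi> v = \<phi> (restrict v {..<l}) \<otimes> g [^] (v l :: int)" for v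
  have carQ: "restrict v {..<l} \<in> carrier P \<and> 0 \<le> v l \<and> v l < int (ord g)" if "v \<in> carrier Q" for v
  proof -
    have v: "v \<in> (\<Pi>\<^sub>E i\<in>{..<Suc l}. carrier (integer_mod_group ((ns @ [ord g]) ! i)))"
      using that by (simp add: Q_def)
    have "v l \<in> carrier (integer_mod_group ((ns @ [ord g]) ! l))"
      using v by (rule PiE_mem) auto
    moreover have "v i \<in> carrier (integer_mod_group (ns ! i))" if "i < l" for i
      using PiE_mem[OF v, of i] that by (simp add: nth_append l_def)
    ultimately show ?thesis
      using m0 by (auto simp: P_def l_def carrier_integer_mod_group)
  qed
  have "\<psi> \<in> hom Q G"
  proof (rule homI)
    fix v assume "v \<in> carrier Q"
    then show "\<psi> v \<in> carrier G"
      using carQ[of v] g HcG[OF \<phi>H] by (simp add: \<psi>_def)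
  next
    fix v w assume vw: "v \<in> carrier Q" "w \<in> carrier Q"
    have "restrict (v \<otimes>\<^bsub>Q\<^esub> w) {..<l} = restrict v {..<l} \<otimes>\<^bsub>P\<^esub> restrict w {..<l}"
      by (auto simp: P_def Q_def fun_eq_iff nth_append l_def restrict_def)
    moreover have "g [^] ((v \<otimes>\<^bsub>Q\<^esub> w) l) = g [^] (v l) \<otimes> g [^] (w l)"
    proof -
      have "(v \<otimes>\<^bsub>Q\<^esub> w) l = (v l + w l) mod int (ord g)"
        by (simp add: Q_def nth_append l_def)
      moreover have "g [^] ((v l + w l) mod int (ord g)) = g [^] (v l + w l)"
        using g by (simp add: int_pow_eq mod_eq_dvd_iff[symmetric])
      ultimately show ?thesis using g by (simp add: int_pow_mult)
    qed
    ultimately show "\<psi> (v \<otimes>\<^bsub>Q\<^esub> w) = \<psi> v \<otimes> \<psi> w"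
      using carQ[OF vw(1)] carQ[OF vw(2)] g
      by (simp add: \<psi>_def \<phi>m m_ac HcG \<phi>H)
  qed
  moreover have "inj_on \<psi> (carrier Q)"
  proof (rule inj_onI)
    fix v w assume vw: "v \<in> carrier Q" "w \<in> carrier Q" and eq: "\<psi> v = \<psi> w"
    have "\<phi> (restrict v {..<l}) = \<phi> (restrict w {..<l}) \<and> g [^] v l = g [^] w l"
      using eq carQ[OF vw(1)] carQ[OF vw(2)] powC \<phi>H unfolding \<psi>_def
      by (intro cancel) auto
    then have 1: "restrict v {..<l} = restrict w {..<l}" and "int (ord g) dvd w l - v l"
      using \<phi> carQ[OF vw(1)] carQ[OF vw(2)] g
      by (auto simp: iso_def bij_betw_def int_pow_eq dest: inj_onD)
    then have "w l mod int (ord g) = v l mod int (ord g)" by (simp add: mod_eq_dvd_iff)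
    then have 2: "v l = w l" using carQ[OF vw(1)] carQ[OF vw(2)] by simp
    show "v = w"
    proof (rule PiE_ext)
      show "v \<in> (\<Pi>\<^sub>E i\<in>{..<Suc l}. carrier (integer_mod_group ((ns @ [ord g]) ! i)))"
        "w \<in> (\<Pi>\<^sub>E i\<in>{..<Suc l}. carrier (integer_mod_group ((ns @ [ord g]) ! i)))"
        using vw by (simp_all add: Q_def)
      fix i assume "i \<in> {..<Suc l}"
      then show "v i = w i" using 2 fun_cong[OF 1, of i] by (cases "i = l") auto
    qed
  qed
  moreover have "carrier G \<subseteq> \<psi> ` carrier Q"
  proof
    fix x assume "x \<in> carrier G"
    then have "x \<in> H <#> generate G {g}" using full by simp
    then obtain h c where h: "h \<in> H" and c: "c \<in> generate G {g}" and x: "x = h \<otimes> c"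
      unfolding set_mult_def by blast
    obtain v where v: "v \<in> carrier P" "h = \<phi> v"
      using \<phi> h by (auto simp: iso_def bij_betw_def)
    obtain k :: int where k: "c = g [^] k" using c unfolding generate_pow[OF g] by auto
    define w where "w = v(l := k mod int (ord g))"
    have "v i \<in> carrier (integer_mod_group (ns ! i))" if "i < l" for i
      using PiE_mem[of v "{..<l}" _ i] v(1) that by (simp add: P_def)
    then have "w \<in> carrier Q"
      using v m0 by (auto simp: w_def Q_def P_def l_def nth_append carrier_integer_mod_group[of "ord g"]
          PiE_iff extensional_def)
    moreover have "restrict w {..<l} = v"
      using v by (auto simp: w_def P_def PiE_iff extensional_def fun_eq_iff)
    moreover have "g [^] (w l) = g [^] k"
      using g by (simp add: w_def int_pow_eq mod_eq_dvd_iff[symmetric])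
    ultimately show "x \<in> \<psi> ` carrier Q"
      using x v k by (auto simp: \<psi>_def intro!: image_eqI[of _ _ w])
  qed
  ultimately have "\<psi> \<in> iso Q G"
    by (auto simp: iso_def bij_betw_def hom_def)
  then have "Q \<cong> G" by (auto simp: is_iso_def)
  then have "G \<cong> Q" using Q group.iso_sym by blast
  then show ?thesis by (simp add: Q_def l_def)
qed

text \<open>Induction on the order: split off the cyclic group of an element \<open>g\<close> of
  maximal order. Its order annihilates the complement, so the factors found there divide
  \<open>ord g\<close>, which can be appended to the chain.\<close>

lemma invariant_factors_exist:
  assumes "comm_group G" and "finite (carrier G)"
  shows "\<exists>ns. is_invariant_factors G ns"
  using assms
proof (induction "card (carrier G)" arbitrary: G rule: less_induct)
  case less
  interpret comm_group G by (rule less.prems)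
  show ?case
  proof (cases "carrier G = {\<one>\<^bsub>G\<^esub>}")
    case True
    have "(\<lambda>x. \<lambda>i\<in>{}. 0) \<in> iso G (product_group {..<length []} (\<lambda>i. integer_mod_group ([] ! i)))"
      using True by (auto simp: iso_def hom_def bij_betw_def)
    then have "is_invariant_factors G []"
      unfolding is_invariant_factors_def is_iso_def by auto
    then show ?thesis ..
  next
    case False
    obtain g where g: "g \<in> carrier G" and expo: "\<And>x. x \<in> carrier G \<Longrightarrow> x [^]\<^bsub>G\<^esub> ord g = \<one>\<^bsub>G\<^esub>"
      using max_ord_is_exponent[OF less.prems(2)] by blast
    have "g \<noteq> \<one>\<^bsub>G\<^esub>"
      using expo False ord_id by (metis one_closed nat_pow_eone singletonI subsetI subset_antisym singletonD)
    then have gt: "ord g > 1"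
      using ord_ge_1[OF less.prems(2) g] ord_eq_1[OF g] by linarith
    obtain H where H: "subgroup H G" and HC: "H \<inter> generate G {g} = {\<one>\<^bsub>G\<^esub>}"
      and full: "H <#>\<^bsub>G\<^esub> generate G {g} = carrier G"
      using cyclic_subgroup_complement[OF less.prems(2) g expo] by blast
    have "g \<notin> H" using HC \<open>g \<noteq> \<one>\<^bsub>G\<^esub>\<close> generate.incl[of g "{g}" G] by blast
    then have "H \<subset> carrier G" using H g subgroup.subset by blast
    then have card: "card (carrier (G\<lparr>carrier := H\<rparr>)) < card (carrier G)"
      using less.prems(2) psubset_card_mono by simp
    have HG: "comm_group (G\<lparr>carrier := H\<rparr>)"
      using H subgroup_imp_group[OF H] subgroup.mem_carrier[OF H]
      by (intro group.group_comm_groupI) (auto simp: m_comm)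
    have finH: "finite (carrier (G\<lparr>carrier := H\<rparr>))"
      using less.prems(2) \<open>H \<subset> carrier G\<close> finite_subset by auto
    obtain ns where ns: "is_invariant_factors (G\<lparr>carrier := H\<rparr>) ns"
      using less.hyps[OF card HG finH] by blast
    have dvd: "n dvd ord g" if "n \<in> set ns" for n
    proof (rule invariant_factor_dvd_exponent[OF _ _ _ _ that])
      show "x [^]\<^bsub>G\<lparr>carrier := H\<rparr>\<^esub> ord g = \<one>\<^bsub>G\<lparr>carrier := H\<rparr>\<^esub>" if "x \<in> carrier (G\<lparr>carrier := H\<rparr>)" for x
        using expo that subgroup.mem_carrier[OF H] by (simp flip: nat_pow_consistent)
    qed (use ns HG in \<open>auto simp: is_invariant_factors_def comm_group_def\<close>)
    have "is_invariant_factors G (ns @ [ord g])"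
      using ns dvd gt iso_product_group_snoc[OF H g less.prems(2) HC full]
      by (auto simp: is_invariant_factors_def sorted_wrt_append)
    then show ?thesis ..
  qed
qed

subsection \<open>Zero-sum free sequences in coordinates\<close>

lemma (in comm_group) seq_sum_closed:
  assumes "set_mset S \<subseteq> carrier G"
  shows "seq_sum G S \<in> carrier G"
  unfolding seq_sum_def using assms by (intro finprod_closed) auto

lemma (in comm_group) seq_sum_add_mset:
  assumes x: "x \<in> carrier G" and S: "set_mset S \<subseteq> carrier G"
  shows "seq_sum G (add_mset x S) = x \<otimes> seq_sum G S"
proof -
  let ?A = "set_mset S - {x}"
  \<comment> \<open>\<open>seq_sum\<close> ranges over distinct elements, so the factor of
    \<open>x\<close> is isolated; an absent \<open>x\<close> has count 0 and contributes 1.\<close>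
  have expand: "seq_sum G T = x [^] count T x \<otimes> (\<Otimes>g\<in>set_mset T - {x}. g [^] count T g)"
    if T: "set_mset T \<subseteq> carrier G" for T
  proof (cases "x \<in># T")
    case True
    then have "seq_sum G T = (\<Otimes>g\<in>insert x (set_mset T - {x}). g [^] count T g)"
      unfolding seq_sum_def by (simp add: insert_absorb)
    also have "\<dots> = x [^] count T x \<otimes> (\<Otimes>g\<in>set_mset T - {x}. g [^] count T g)"
      using T x by (intro finprod_insert) auto
    finally show ?thesis .
  next
    case False
    then have "set_mset T - {x} = set_mset T" "count T x = 0"
      by (auto simp: not_in_iff)
    moreover have "(\<Otimes>g\<in>set_mset T. g [^] count T g) \<in> carrier G"
      using T by (intro finprod_closed) auto
    ultimately show ?thesis
      unfolding seq_sum_def using x by simp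
  qed
  have "(\<Otimes>g\<in>set_mset (add_mset x S) - {x}. g [^] count (add_mset x S) g) = (\<Otimes>g\<in>?A. g [^] count S g)"
    using S by (intro finprod_cong') auto
  moreover have "(\<Otimes>g\<in>?A. g [^] count S g) \<in> carrier G"
    using S by (intro finprod_closed) auto
  ultimately show ?thesis
    using expand[of S] expand[of "add_mset x S"] x S by (simp add: m_ac)
qed

text \<open>Lets sequences be given by integer vectors: \<open>elem\<close> reduces each coordinate
  modulo its invariant factor and pulls the result back along the isomorphism.\<close>

lemma zero_sum_coordinates:
  assumes "is_invariant_factors G ns" and "comm_group G"
  obtains elem :: "(nat \<Rightarrow> int) \<Rightarrow> 'a" where "\<And>v. elem v \<in> carrier G"
    and "\<And>B i. zero_sum G (image_mset elem B) \<Longrightarrow> i < length ns \<Longrightarrow> int (ns ! i) dvd (\<Sum>v\<in>#B. v i)"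
proof -
  interpret comm_group G by fact
  define P where "P = product_group {..<length ns} (\<lambda>i. integer_mod_group (ns ! i))"
  have "G \<cong> P" using assms by (simp add: is_invariant_factors_def P_def)
  then obtain \<phi> where \<phi>: "\<phi> \<in> iso G P" by (auto simp: is_iso_def)
  have P: "group P" by (simp add: P_def)
  interpret \<phi>: group_hom G P \<phi>
    using \<phi> P by (simp add: group_hom_def group_hom_axioms_def iso_def)
  have pos: "ns ! i > 0" if "i < length ns" for i
    using assms(1) that nth_mem by (fastforce simp: is_invariant_factors_def)
  define e where "e v = (\<lambda>i\<in>{..<length ns}. v i mod int (ns ! i))" for v :: "nat \<Rightarrow> int"
  define elem where "elem v = inv_into (carrier G) \<phi> (e v)" for v
  have eP: "e v \<in> carrier P" for v
    using pos by (auto simp: e_def P_def carrier_integer_mod_group)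
  then have "e v \<in> \<phi> ` carrier G" for v
    using \<phi> by (simp add: iso_def bij_betw_def)
  then have elem: "elem v \<in> carrier G" "\<phi> (elem v) = e v" for v
    unfolding elem_def by (auto intro: inv_into_into f_inv_into_f)
  have sum: "\<phi> (seq_sum G (image_mset elem B)) = e (\<lambda>i. \<Sum>v\<in>#B. v i)" for B
  proof (induction B)
    case empty
    have "\<phi> (seq_sum G {#}) = \<one>\<^bsub>P\<^esub>" by (simp add: seq_sum_def)
    then show ?case by (auto simp: P_def e_def)
  next
    case (add v B)
    have "set_mset (image_mset elem B) \<subseteq> carrier G" using elem by auto
    then have "\<phi> (seq_sum G (image_mset elem (add_mset v B))) = e v \<otimes>\<^bsub>P\<^esub> e (\<lambda>i. \<Sum>v\<in>#B. v i)"
      using elem add by (simp add: seq_sum_add_mset seq_sum_closed)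
    also have "\<dots> = e (\<lambda>i. \<Sum>v\<in>#add_mset v B. v i)"
      by (auto simp: P_def e_def fun_eq_iff mod_add_eq)
    finally show ?case .
  qed
  have "int (ns ! i) dvd (\<Sum>v\<in>#B. v i)"
    if "zero_sum G (image_mset elem B)" and i: "i < length ns" for B i
  proof -
    have "e (\<lambda>i. \<Sum>v\<in>#B. v i) = \<one>\<^bsub>P\<^esub>"
      using sum[of B] that(1) by (simp add: zero_sum_def)
    then have "e (\<lambda>i. \<Sum>v\<in>#B. v i) i = \<one>\<^bsub>P\<^esub> i" by simp
    then show ?thesis using i by (simp add: e_def P_def mod_eq_0_iff_dvd)
  qed
  with elem(1) show thesis by (rule that)
qed

text \<open>\<open>davenport\<close> is a \<open>LEAST\<close>, so some valid length must be
  exhibited first: among \<open>N * N\<close> terms, \<open>N = |G|\<close>, one element occurs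
  \<open>N\<close> times, and these copies have sum zero.\<close>

lemma size_less_davenport:
  assumes "comm_group G" and fin: "finite (carrier G)" and S: "seq_over G S"
    and free: "\<And>T. T \<subseteq># S \<Longrightarrow> zero_sum G T \<Longrightarrow> T = {#}"
  shows "size S < davenport G"
proof -
  interpret comm_group G by fact
  let ?P = "\<lambda>d. \<forall>S. seq_over G S \<and> d \<le> size S \<longrightarrow> (\<exists>T. T \<subseteq># S \<and> T \<noteq> {#} \<and> zero_sum G T)"
  define N where "N = card (carrier G)"
  have N: "N > 0" using fin one_closed by (auto simp: N_def card_gt_0_iff)
  have "?P (N * N)"
  proof (intro allI impI, elim conjE)
    fix S assume S: "seq_over G S" and le: "N * N \<le> size S"
    have "\<exists>g\<in>set_mset S. N \<le> count S g"
    proof (rule ccontr)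
      assume "\<not> ?thesis"
      then have "count S g \<le> N - 1" if "g \<in># S" for g using that by (auto simp: not_le)
      then have "size S \<le> card (set_mset S) * (N - 1)"
        unfolding size_multiset_overloaded_eq using sum_bounded_above[of "set_mset S" "count S" "N - 1"] by simp
      also have "\<dots> \<le> N * (N - 1)"
        using S fin by (auto simp: seq_over_def N_def intro!: card_mono)
      also have "\<dots> < N * N" using N by simp
      finally show False using le by simp
    qed
    then obtain g where g: "g \<in># S" "N \<le> count S g" by blast
    then have "g \<in> carrier G" using S by (auto simp: seq_over_def)
    then have "g [^]\<^bsub>G\<^esub> N = \<one>\<^bsub>G\<^esub>" using pow_order_eq_1 by (simp add: N_def order_def)
    then have "zero_sum G (replicate_mset N g)"
      using N \<open>g \<in> carrier G\<close> by (simp add: zero_sum_def seq_sum_def)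
    moreover have "replicate_mset N g \<subseteq># S" using g by (simp add: count_le_replicate_mset_subset_eq)
    ultimately show "\<exists>T. T \<subseteq># S \<and> T \<noteq> {#} \<and> zero_sum G T" using N
      by (metis replicate_mset_eq_empty_iff less_not_refl)
  qed
  then have "?P (davenport G)" unfolding davenport_def by (rule LeastI[of ?P])
  then show ?thesis using S free by (meson not_le)
qed

lemma sum_mset_eq_sum_count:
  assumes "finite I" "set_mset B \<subseteq> I"
  shows "(\<Sum>b\<in>#B. f b) = (\<Sum>b\<in>I. int (count B b) * f b)"
  using assms(2)
proof (induction B)
  case (add c B)
  have "(\<Sum>b\<in>I. int (count (add_mset c B) b) * f b)
      = (\<Sum>b\<in>I. int (count B b) * f b + (if b = c then f b else 0))"
    by (intro sum.cong) (auto simp: algebra_simps)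
  also have "\<dots> = (\<Sum>b\<in>I. int (count B b) * f b) + f c"
    using assms(1) add.prems by (simp add: sum.distrib)
  finally show ?case using add by simp
qed simp

text \<open>Zero-sum freeness becomes a system of divisibilities in the multiplicities
  \<open>x b\<close>. Terms are indexed by \<open>I\<close>, so \<open>vec\<close> may repeat
  values.\<close>

lemma sum_less_davenport:
  fixes vec :: "'i \<Rightarrow> nat \<Rightarrow> int" and mult :: "'i \<Rightarrow> nat"
  assumes ns: "is_invariant_factors G ns" and G: "comm_group G" and fin: "finite (carrier G)"
    and I: "finite I"
    and free: "\<And>x :: 'i \<Rightarrow> nat. (\<And>b. b \<in> I \<Longrightarrow> x b \<le> mult b) \<Longrightarrow>
       (\<And>i. i < length ns \<Longrightarrow> int (ns ! i) dvd (\<Sum>b\<in>I. int (x b) * vec b i)) \<Longrightarrow>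
       (\<And>b. b \<in> I \<Longrightarrow> x b = 0)"
  shows "(\<Sum>b\<in>I. mult b) < davenport G"
proof -
  obtain elem where elem: "\<And>v. elem v \<in> carrier G"
    "\<And>B i. zero_sum G (image_mset elem B) \<Longrightarrow> i < length ns \<Longrightarrow> int (ns ! i) dvd (\<Sum>v\<in>#B. v i)"
    using zero_sum_coordinates[OF ns G] by blast
  define M where "M = (\<Sum>b\<in>I. replicate_mset (mult b) b)"
  have count_M: "count M b = (if b \<in> I then mult b else 0)" for b
    unfolding M_def using I by (simp add: count_sum sum.delta)
  have "size (image_mset (elem \<circ> vec) M) < davenport G"
  proof (rule size_less_davenport[OF G fin])
    show "seq_over G (image_mset (elem \<circ> vec) M)"
      using elem by (auto simp: seq_over_def)
    fix T assume "T \<subseteq># image_mset (elem \<circ> vec) M" and zs: "zero_sum G T"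
    \<comment> \<open>A subsequence of the image lifts to a multiset of indices, whose counts serve
      as \<open>x\<close>.\<close>
    then obtain B where B: "B \<subseteq># M" "T = image_mset (elem \<circ> vec) B"
      by (metis image_mset_eq_plusD subset_mset.le_iff_add)
    have sub: "set_mset B \<subseteq> I"
      using set_mset_mono[OF B(1)] count_M by (auto simp: subset_iff count_inI split: if_splits)
        (metis count_M not_in_iff)
    have "count B b = 0" if "b \<in> I" for b
    proof (rule free[OF _ _ that])
      show "count B b \<le> mult b" if "b \<in> I" for b
        using mset_subset_eq_count[OF B(1), of b] count_M that by simp
      fix i assume "i < length ns"
      then have "int (ns ! i) dvd (\<Sum>v\<in>#image_mset vec B. v i)"
        using elem(2)[of "image_mset vec B"] zs B(2) by (simp add: multiset.map_comp)
      also have "(\<Sum>v\<in>#image_mset vec B. v i) = (\<Sum>b\<in>I. int (count B b) * vec b i)"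
        using sum_mset_eq_sum_count[OF I sub, of "\<lambda>b. vec b i"] by (simp add: multiset.map_comp comp_def)
      finally show "int (ns ! i) dvd (\<Sum>b\<in>I. int (count B b) * vec b i)" .
    qed
    then have "B = {#}" using sub by (metis multiset_nonemptyE not_in_iff subsetD)
    then show "T = {#}" using B by simp
  qed
  also have "size (image_mset (elem \<circ> vec) M) = (\<Sum>b\<in>I. mult b)"
    unfolding M_def by (simp add: size_multiset_sum)
  finally show ?thesis .
qed

subsection \<open>Linear forms over a prime field\<close>

fun residue_vectors :: "nat \<Rightarrow> nat \<Rightarrow> (nat \<Rightarrow> int) list" where
  "residue_vectors l 0 = [\<lambda>_. 0]"
| "residue_vectors l (Suc d) =
     concat (map (\<lambda>v. map (\<lambda>c. v(d := int c)) [0..<l]) (residue_vectors l d))"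

text \<open>Last nonzero entry 1: one representative of each point of the projective space over \<open>\<int>/l\<close>.\<close>

fun monic_vectors :: "nat \<Rightarrow> nat \<Rightarrow> (nat \<Rightarrow> int) list" where
  "monic_vectors l 0 = []"
| "monic_vectors l (Suc d) =
     map (\<lambda>v. v(d := 0)) (monic_vectors l d) @ map (\<lambda>v. v(d := 1)) (residue_vectors l d)"

definition dot :: "nat \<Rightarrow> (nat \<Rightarrow> int) \<Rightarrow> (nat \<Rightarrow> int) \<Rightarrow> int" where
  "dot d v s = (\<Sum>i<d. v i * s i)"

lemma dot_upd: "dot (Suc d) (v(d := c)) s = dot d v s + c * s d"
  by (simp add: dot_def)

lemma sum_list_concat_map:
  "sum_list (map f (concat (map g xs))) = (\<Sum>x\<leftarrow>xs. \<Sum>y\<leftarrow>g x. f y)"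
  by (induction xs) auto

lemma length_residue_vectors: "length (residue_vectors l d) = l ^ d"
  by (induction d) (simp_all add: length_concat comp_def sum_list_triv)

text \<open>For prime \<open>l\<close> this is the number \<open>(l^d - 1) / (l - 1)\<close> of
  points of a projective space, written without division.\<close>

lemma length_monic_vectors:
  assumes "l > 0"
  shows "(l - 1) * length (monic_vectors l d) + 1 = l ^ d"
proof (induction d)
  case (Suc d)
  have "(l - 1) * length (monic_vectors l (Suc d)) + 1 = (l - 1) * l ^ d + l ^ d"
    using Suc by (simp add: length_residue_vectors algebra_simps)
  also have "\<dots> = l ^ Suc d"
    using assms by (cases l) auto
  finally show ?case .
qed simp

text \<open>If \<open>l\<close> divides \<open>b\<close>, the value is constant modulo
  \<open>l\<close>; otherwise \<open>b\<close> is invertible and exactly one \<open>c\<close> gives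
  0.\<close>

lemma count_nonzero_affine_values:
  fixes l :: nat and a b :: int
  assumes l: "Factorial_Ring.prime l"
  shows "(\<Sum>c<l. of_bool (\<not> int l dvd a + int c * b) :: nat) =
    (if int l dvd b then l * of_bool (\<not> int l dvd a) else l - 1)"
proof (cases "int l dvd b")
  case True
  then have "int l dvd a + int c * b \<longleftrightarrow> int l dvd a" for c
    by (metis dvd_add_left_iff dvd_mult)
  then show ?thesis using True by simp
next
  case False
  have lp: "Factorial_Ring.prime (int l)" "l > 1" using l prime_gt_1_nat by auto
  then have "coprime (int l) b" using False prime_imp_coprime by blast
  then obtain u v where uv: "u * int l + v * b = 1"
    using bezout_int[of "int l" b] by auto
  define c0 where "c0 = nat ((- a * v) mod int l)"
  have c0: "c0 < l" "int c0 = (- a * v) mod int l"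
    using lp by (auto simp: c0_def nat_less_iff)
  have "int l dvd - a * v - int c0"
    unfolding c0 by (simp add: dvd_minus_mod)
  then have "int l dvd a * u * int l - (- a * v - int c0) * b"
    by (intro dvd_diff) auto
  also have "a * u * int l - (- a * v - int c0) * b = a * (u * int l + v * b) + int c0 * b"
    by (simp add: algebra_simps)
  finally have "int l dvd a + int c0 * b" using uv by simp
  then have iff: "int l dvd a + int c * b \<longleftrightarrow> c = c0" if "c < l" for c
  proof (intro iffI)
    assume "int l dvd a + int c * b"
    with \<open>int l dvd a + int c0 * b\<close> have "int l dvd (a + int c * b) - (a + int c0 * b)"
      by (rule dvd_diff[rotated])
    then have "int l dvd (int c - int c0) * b" by (simp add: algebra_simps)
    then have "int l dvd int c - int c0" using lp False prime_dvd_mult_iff by blast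
    then have "int c mod int l = int c0 mod int l" by (simp add: mod_eq_dvd_iff)
    then show "c = c0" using c0(1) that by simp
  qed auto
  have "(\<Sum>c<l. of_bool (\<not> int l dvd a + int c * b) :: nat) = (\<Sum>c\<in>{..<l} - {c0}. 1)"
    by (rule sum.mono_neutral_cong_right) (auto simp: iff)
  then show ?thesis using False c0 by simp
qed

text \<open>A nonconstant affine form takes every residue equally often, whatever \<open>a\<close>
  is. If \<open>l\<close> does not divide \<open>s d\<close>, the last entry of \<open>v\<close>
  alone shows this; otherwise it has no influence and the induction applies.\<close>

lemma count_nonzero_affine_forms:
  assumes l: "Factorial_Ring.prime l" and "\<exists>i<d. \<not> int l dvd s i"
  shows "(\<Sum>v\<leftarrow>residue_vectors l d. of_bool (\<not> int l dvd a + dot d v s) :: nat) = (l - 1) * l ^ (d - 1)"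
  using assms(2)
proof (induction d)
  case (Suc d)
  have "(\<Sum>v\<leftarrow>residue_vectors l (Suc d). of_bool (\<not> int l dvd a + dot (Suc d) v s) :: nat)
      = (\<Sum>v\<leftarrow>residue_vectors l d. \<Sum>c<l. of_bool (\<not> int l dvd (a + dot d v s) + int c * s d))"
    by (simp add: sum_list_concat_map dot_upd comp_def add.assoc interv_sum_list_conv_sum_set_nat
        atLeast0LessThan del: of_bool_not_iff)
  also have "\<dots> = (\<Sum>v\<leftarrow>residue_vectors l d.
      if int l dvd s d then l * of_bool (\<not> int l dvd a + dot d v s) else l - 1)"
    by (simp only: count_nonzero_affine_values[OF l])
  also have "\<dots> = (l - 1) * l ^ d"
  proof (cases "int l dvd s d")
    case False
    then show ?thesis by (simp add: sum_list_triv length_residue_vectors)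
  next
    case True
    then have ex: "\<exists>i<d. \<not> int l dvd s i" using Suc.prems less_Suc_eq by blast
    then have "d > 0" by auto
    then show ?thesis
      using True Suc.IH[OF ex] by (cases d) (simp_all add: sum_list_const_mult)
  qed
  finally show ?case by simp
qed simp

text \<open>Counts the projective points off the hyperplane orthogonal to \<open>s\<close>. Vectors
  ending in 1 contribute an affine count with constant \<open>s d\<close>.\<close>

lemma count_nonzero_monic_forms:
  assumes l: "Factorial_Ring.prime l"
  shows "(\<Sum>v\<leftarrow>monic_vectors l d. of_bool (\<not> int l dvd dot d v s) :: nat) =
    (if \<exists>i<d. \<not> int l dvd s i then l ^ (d - 1) else 0)"
proof (induction d)
  case (Suc d)
  have eq: "(\<Sum>v\<leftarrow>monic_vectors l (Suc d). of_bool (\<not> int l dvd dot (Suc d) v s) :: nat)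
     = (\<Sum>v\<leftarrow>monic_vectors l d. of_bool (\<not> int l dvd dot d v s))
      + (\<Sum>v\<leftarrow>residue_vectors l d. of_bool (\<not> int l dvd s d + dot d v s))"
    by (simp add: dot_upd comp_def add.commute del: of_bool_not_iff)
  show ?case
  proof (cases "\<exists>i<d. \<not> int l dvd s i")
    case True
    then have "d > 0" by auto
    then have "l ^ (d - 1) + (l - 1) * l ^ (d - 1) = l ^ d"
      using prime_gt_0_nat[OF l] by (cases d; cases l) auto
    moreover have "\<exists>i<Suc d. \<not> int l dvd s i" using True less_SucI by blast
    ultimately show ?thesis
      unfolding eq Suc.IH count_nonzero_affine_forms[OF l True] using True by simp
  next
    case False
    then have "int l dvd dot d v s" for v
      unfolding dot_def by (intro dvd_sum) auto
    then have "int l dvd s d + dot d v s \<longleftrightarrow> int l dvd s d" for v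
      by (meson dvd_add_left_iff)
    then show ?thesis
      unfolding eq Suc.IH using False
      by (auto simp: sum_list_triv length_residue_vectors less_Suc_eq)
  qed
qed simp

lemma sum_residues_of_opposites:
  fixes l x :: int
  assumes "l > 0"
  shows "x mod l + (- x) mod l = l * of_bool (\<not> l dvd x)"
  using assms by (simp add: zmod_zminus1_eq_if mod_eq_0_iff_dvd)

lemma dot_uminus: "dot d (\<lambda>i. - v i) s = - dot d v s"
  by (simp add: dot_def sum_negf)

lemma int_sum_list: "int (\<Sum>x\<leftarrow>xs. f x) = (\<Sum>x\<leftarrow>xs. int (f x))"
  by (induction xs) auto

text \<open>
  The residues \<open>x mod l\<close> and \<open>- x mod l\<close> add up to \<open>l\<close> unless \<open>l\<close> divides \<open>x\<close>, so the monic forms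
  together with their negatives work; for \<open>l = 2\<close> both coincide and the monic ones alone suffice,
  which is needed for the bound on the length.
\<close>

lemma separating_forms_exist:
  assumes l: "Factorial_Ring.prime l"
  obtains W :: "(nat \<Rightarrow> int) list" and e :: nat
  where "length W < l ^ d"
    and "\<And>s. (\<Sum>w\<leftarrow>W. (- dot d w s) mod int l) = (if \<exists>i<d. \<not> int l dvd s i then int l ^ e else 0)"
proof (cases "l = 2")
  case True
  have "(- dot d v s) mod 2 = int (of_bool (\<not> 2 dvd dot d v s))" for v s
    by (simp add: mod2_eq_if)
  then have "(\<Sum>w\<leftarrow>monic_vectors l d. (- dot d w s) mod int l) =
       int (\<Sum>w\<leftarrow>monic_vectors l d. of_bool (\<not> int l dvd dot d w s))" for s
    using True by (simp add: int_sum_list comp_def)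
  then show thesis
    using that[of "monic_vectors l d" "d - 1"] length_monic_vectors[of l d] True
    unfolding count_nonzero_monic_forms[OF l] by auto
next
  case False
  have l3: "l \<ge> 3" using False prime_ge_2_nat[OF l] by linarith
  let ?M = "monic_vectors l d"
  let ?W = "?M @ map (\<lambda>v i. - v i) ?M"
  have "(\<Sum>w\<leftarrow>?W. (- dot d w s) mod int l) = (if \<exists>i<d. \<not> int l dvd s i then int l ^ d else 0)" for s
  proof -
    have "(- x) mod int l + x mod int l = int l * int (of_bool (\<not> int l dvd x))" for x
      using sum_residues_of_opposites[of "int l" x] l3 by (simp add: add.commute)
    then have "(\<Sum>w\<leftarrow>?W. (- dot d w s) mod int l) =
        (\<Sum>w\<leftarrow>?M. int l * int (of_bool (\<not> int l dvd dot d w s)))"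
      by (simp add: comp_def dot_uminus flip: sum_list_addf)
    also have "\<dots> = int l * int (\<Sum>w\<leftarrow>?M. of_bool (\<not> int l dvd dot d w s))"
      by (simp only: int_sum_list sum_list_const_mult)
    also have "\<dots> = (if \<exists>i<d. \<not> int l dvd s i then int l ^ d else 0)"
      unfolding count_nonzero_monic_forms[OF l] by (cases d) auto
    finally show ?thesis .
  qed
  moreover have "length ?W < l ^ d"
  proof -
    \<comment> \<open>Here \<open>l - 1\<close> is at least 2 and absorbs the doubling, since
      \<open>(l - 1) * length ?M = l^d - 1\<close>.\<close>
    have "2 * length ?M \<le> (l - 1) * length ?M" using l3 by (intro mult_le_mono1) simp
    moreover have "length ?W = 2 * length ?M" by simp
    ultimately show ?thesis using length_monic_vectors[of l d] l3 by linarith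
  qed
  ultimately show thesis using that by blast
qed

subsection \<open>Long zero-sum free sequences\<close>

text \<open>Rests on \<open>l \<le> 2^(l - 1)\<close>. It ensures that the available copies of an
  invariant factor can host all forms.\<close>

lemma power_le_two_power:
  fixes l d t :: nat
  assumes "l > 0" and "d * (l - 1) \<le> t"
  shows "l ^ d \<le> 2 ^ t"
proof -
  have "l \<le> 2 ^ (l - 1)"
    using less_exp[of "l - 1"] assms(1) by linarith
  then have "l ^ d \<le> (2 ^ (l - 1)) ^ d" by (rule power_mono) simp
  also have "\<dots> = 2 ^ (d * (l - 1))" by (simp add: power_mult[symmetric] mult.commute)
  also have "\<dots> \<le> 2 ^ t" using assms(2) by simp
  finally show ?thesis .
qed

lemma sum_by_blocks:
  fixes x f :: "nat \<Rightarrow> int" and blk :: "nat \<Rightarrow> nat"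
  assumes "\<And>j. j < t \<Longrightarrow> blk j < d"
  shows "(\<Sum>j<t. x j * f (blk j)) = (\<Sum>B<d. f B * (\<Sum>j\<in>{j\<in>{..<t}. blk j = B}. x j))"
proof -
  have "(\<Sum>B<d. f B * (\<Sum>j\<in>{j\<in>{..<t}. blk j = B}. x j))
      = (\<Sum>B<d. \<Sum>j\<in>{j\<in>{..<t}. blk j = B}. x j * f (blk j))"
    by (intro sum.cong refl) (simp add: sum_distrib_left mult.commute)
  also have "\<dots> = (\<Sum>j<t. x j * f (blk j))"
    using assms by (intro sum.group) auto
  finally show ?thesis ..
qed

lemma block_count_bound:
  fixes k :: nat
  assumes "k > 0"
  shows "card {j \<in> {..<t}. j div k = B} \<le> k"
proof -
  have "{j \<in> {..<t}. j div k = B} \<subseteq> {B * k..<B * k + k}"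
  proof
    fix j assume "j \<in> {j \<in> {..<t}. j div k = B}"
    then have "j = B * k + j mod k" by auto
    moreover have "j mod k < k" using assms by simp
    ultimately show "j \<in> {B * k..<B * k + k}" by auto
  qed
  then have "card {j \<in> {..<t}. j div k = B} \<le> card {B * k..<B * k + k}"
    by (intro card_mono) auto
  then show ?thesis by simp
qed

text \<open>For \<open>n = q * l\<close>, the residue of \<open>- q * D\<close> modulo
  \<open>n\<close> is \<open>q\<close> times that of \<open>- D\<close> modulo \<open>l\<close>.
  Thus a coordinate condition determines the multiplicity of a basis element.\<close>

lemma dvd_imp_eq_mod:
  fixes x n q l D :: int
  assumes "n dvd x + q * D" "n = q * l" "0 \<le> x" "x < n"
  shows "x = q * ((- D) mod l)"
proof -
  have "n dvd x - (- (q * D))" using assms(1) by simp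
  then have "x mod n = (- (q * D)) mod n" by (simp add: mod_eq_dvd_iff)
  then show ?thesis using assms by (simp add: mult_mod_right)
qed

text \<open>After cancelling \<open>q\<close>, one summand vanishes modulo \<open>p\<close> and the
  other modulo \<open>l\<close>, so a single condition splits into two.\<close>

lemma dvd_two_primes:
  fixes p l q w Z N :: int
  assumes pl: "Factorial_Ring.prime p" "Factorial_Ring.prime l" "p \<noteq> l" and "q \<noteq> 0"
    and w: "\<not> p dvd w" and dvd: "p * l * q dvd l * q * (w * Z) + p * q * N"
  shows "p dvd Z" "l dvd N"
proof -
  have "p * l * q dvd (l * (w * Z) + p * N) * q" using dvd by (simp add: algebra_simps)
  then have *: "p * l dvd l * (w * Z) + p * N" using \<open>q \<noteq> 0\<close> by simp
  have "p dvd l * (w * Z) + p * N" using * by (rule dvd_mult_left)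
  then have "p dvd l * (w * Z)" by (simp add: dvd_add_left_iff)
  then show "p dvd Z"
    using pl w by (metis prime_dvd_mult_iff primes_dvd_imp_eq)
  have "l dvd l * (w * Z) + p * N" using * by (rule dvd_mult_right)
  then have "l dvd p * N" by (simp add: dvd_add_right_iff)
  then show "l dvd N"
    using pl by (metis prime_dvd_mult_iff primes_dvd_imp_eq)
qed

text \<open>The last coordinate of a subsum is \<open>(m/p) * w * Z + (m/l) * N\<close> modulo
  \<open>m\<close>, where \<open>Z\<close> adds the residues forced on the shifted basis elements
  and \<open>N\<close> counts the chosen additional terms. If it vanishes, \<open>p\<close> divides
  \<open>Z\<close>, which empties the blocks below \<open>d\<close>, and \<open>l\<close> divides
  \<open>N\<close>, which then empties block \<open>d\<close>.\<close>

lemma davenport_gain: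
  assumes ns: "is_invariant_factors G (ns @ [m])" and G: "comm_group G" and fin: "finite (carrier G)"
    and p: "Factorial_Ring.prime p" and l: "Factorial_Ring.prime l" and "p \<noteq> l"
    and n: "n = p ^ a * (l * w)" "\<not> p dvd w" and m: "m = n * (p * k)"
    and t: "t > 0" and card: "2 ^ (t - 1) \<le> card {i. i < length ns \<and> ns ! i = n}"
  shows "(\<Sum>i<length ns. ns ! i - 1) + t < davenport G"
proof -
  define R where "R = length ns"
  \<comment> \<open>The \<open>t\<close> terms fall into blocks 0 to \<open>d\<close> of size at
    most \<open>l - 1\<close>. Block \<open>d\<close> needs no form, and starting from
    \<open>t - 1\<close> keeps \<open>l^d \<le> 2^(t - 1)\<close>.\<close>
  define d where "d = (t - 1) div (l - 1)"
  define blk where "blk j = j div (l - 1)" for j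
  have l1: "l > 1" "l - 1 > 0" using prime_gt_1_nat[OF l] by auto
  have pos: "ns ! i > 1" if "i < R" for i
    using ns that by (auto simp: is_invariant_factors_def R_def)
  have m1: "m > 1" using ns by (auto simp: is_invariant_factors_def)
  have q0: "p ^ a * w * k > 0" using m1 by (auto simp: m n(1) intro: gr0I)
  have blk: "blk j < Suc d" if "j < t" for j
    using that div_le_mono[of j "t - 1" "l - 1"] by (simp add: blk_def d_def less_Suc_eq_le)
  obtain W e where W: "length W < l ^ d"
    and sep: "\<And>s. (\<Sum>v\<leftarrow>W. (- dot d v s) mod int l) = (if \<exists>i<d. \<not> int l dvd s i then int l ^ e else 0)"
    using separating_forms_exist[OF l, of d] by metis
  have "d * (l - 1) \<le> t - 1" by (simp add: d_def)
  then have "l ^ d \<le> 2 ^ (t - 1)" using power_le_two_power[of l d "t - 1"] l1 by simp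
  then have "length W \<le> card {i. i < R \<and> ns ! i = n}"
    using W card unfolding R_def by linarith
  from obtain_subset_with_card_n[OF this] obtain K
    where K: "K \<subseteq> {i. i < R \<and> ns ! i = n}" "card K = length W" "finite K"
    by blast
  then obtain \<beta> where \<beta>: "bij_betw \<beta> K {0..<length W}"
    using ex_bij_betw_finite_nat by metis
  \<comment> \<open>Each index in \<open>K\<close> carries one form, extended by 0 to block
    \<open>d\<close>.\<close>
  define form where "form i = (\<lambda>B. if B < d then (W ! \<beta> i) B else 0)" for i
  have KR: "i < R" "ns ! i = n" if "i \<in> K" for i using K that by auto
  define mult :: "nat + nat \<Rightarrow> nat" where "mult = case_sum (\<lambda>i. ns ! i - 1) (\<lambda>_. 1)"
  \<comment> \<open>\<open>Inl i\<close> is the \<open>i\<close>-th basis element, shifted along the last one if \<open>i \<in> K\<close>; \<open>Inr j\<close> is the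
     \<open>j\<close>-th additional term. Since the blocks have fewer than \<open>l\<close> elements, a block sum divisible by \<open>l\<close>
     vanishes, and the block \<open>d\<close> is controlled by the \<open>l\<close>-part of the last coordinate.\<close>
  define vec :: "nat + nat \<Rightarrow> nat \<Rightarrow> int" where
    "vec = case_sum
       (\<lambda>i c. if c = i then 1 else if c = R \<and> i \<in> K then int (l * w * k) else 0)
       (\<lambda>j c. if c = R then int (p ^ a * w * p * k)
              else if c \<in> K then int (p ^ a * w) * form c (blk j) else 0)"
  have "(\<Sum>b\<in>{..<R} <+> {..<t}. mult b) < davenport G"
  proof (rule sum_less_davenport[OF ns G fin])
    show "finite ({..<R} <+> {..<t})" by simp
    fix x b
    assume le: "\<And>b. b \<in> {..<R} <+> {..<t} \<Longrightarrow> x b \<le> mult b"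
      and dvd: "\<And>c. c < length (ns @ [m]) \<Longrightarrow>
             int ((ns @ [m]) ! c) dvd (\<Sum>b\<in>{..<R} <+> {..<t}. int (x b) * vec b c)"
    define y where "y j = int (x (Inr j))" for j
    define s where "s B = (\<Sum>j\<in>{j\<in>{..<t}. blk j = B}. y j)" for B
    have y: "0 \<le> y j" "y j \<le> 1" if "j < t" for j
      using le[OF InrI, of j] that by (simp_all add: y_def mult_def)
    have xle: "x (Inl i) < ns ! i" if "i < R" for i
      using le[OF InlI, of i] that pos[OF that] by (simp add: mult_def)
    have sle: "0 \<le> s B" "s B < int l" for B
    proof -
      show "0 \<le> s B" unfolding s_def using y by (intro sum_nonneg) auto
      have "s B \<le> (\<Sum>j\<in>{j\<in>{..<t}. blk j = B}. 1 :: int)"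
        unfolding s_def using y by (intro sum_mono) auto
      moreover have "(\<Sum>j\<in>{j\<in>{..<t}. blk j = B}. 1 :: int) < int l"
        using block_count_bound[OF l1(2), of t B] l1 by (simp add: blk_def)
      ultimately show "s B < int l" by linarith
    qed
    have sumform: "(\<Sum>j<t. y j * form i (blk j)) = dot d (W ! \<beta> i) s" for i
    proof -
      have "(\<Sum>j<t. y j * form i (blk j)) = (\<Sum>B<Suc d. form i B * s B)"
        unfolding s_def using blk by (rule sum_by_blocks)
      also have "\<dots> = (\<Sum>B<d. form i B * s B)" by (simp add: form_def)
      also have "\<dots> = dot d (W ! \<beta> i) s" by (simp add: form_def dot_def)
      finally show ?thesis .
    qed
    have sumy: "(\<Sum>j<t. y j) = (\<Sum>B<Suc d. s B)"
      using sum_by_blocks[of t blk "Suc d" y "\<lambda>_. 1"] blk by (simp add: s_def)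
    have coord: "(\<Sum>b\<in>{..<R} <+> {..<t}. int (x b) * vec b c) =
        (\<Sum>i<R. int (x (Inl i)) * vec (Inl i) c) + (\<Sum>j<t. y j * vec (Inr j) c)" for c
      by (simp add: sum.Plus y_def comp_def)
    have coord_lt: "int (ns ! c) dvd int (x (Inl c)) + (\<Sum>j<t. y j * vec (Inr j) c)" if "c < R" for c
    proof -
      have "(\<Sum>i<R. int (x (Inl i)) * vec (Inl i) c) = (\<Sum>i<R. if c = i then int (x (Inl i)) else 0)"
        using that by (intro sum.cong) (auto simp: vec_def)
      then have "(\<Sum>i<R. int (x (Inl i)) * vec (Inl i) c) = int (x (Inl c))"
        using that by simp
      then show ?thesis
        using dvd[of c] that coord[of c] by (simp add: R_def nth_append)
    qed
    \<comment> \<open>Additional terms have coordinate 0 here, so the basis element faces its own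
      order alone.\<close>
    have x_out: "x (Inl i) = 0" if "i < R" "i \<notin> K" for i
    proof -
      have "int (ns ! i) dvd int (x (Inl i))"
        using coord_lt[OF that(1)] that by (simp add: vec_def)
      then show ?thesis using xle[OF that(1)] by (auto dest: dvd_imp_le)
    qed
    have x_in: "int (x (Inl i)) = int (p ^ a * w) * ((- dot d (W ! \<beta> i) s) mod int l)" if "i \<in> K" for i
    proof (rule dvd_imp_eq_mod)
      have "(\<Sum>j<t. y j * vec (Inr j) i) = int (p ^ a * w) * (\<Sum>j<t. y j * form i (blk j))"
        using that KR[OF that] by (simp add: vec_def sum_distrib_left mult_ac)
      then show "int (ns ! i) dvd int (x (Inl i)) + int (p ^ a * w) * dot d (W ! \<beta> i) s"
        using coord_lt[OF KR(1)[OF that]] by (simp add: sumform)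
      show "int (ns ! i) = int (p ^ a * w) * int l"
        using KR(2)[OF that] by (simp add: n(1))
      show "int (x (Inl i)) < int (ns ! i)"
        using xle[OF KR(1)[OF that]] by (simp only: of_nat_less_iff)
    qed simp
    define Z where "Z = (\<Sum>v\<leftarrow>W. (- dot d v s) mod int l)"
    have Z: "(\<Sum>i\<in>K. (- dot d (W ! \<beta> i) s) mod int l) = Z"
      unfolding Z_def using \<beta>
      by (simp add: sum_list_sum_nth sum.reindex_bij_betw[of \<beta> K "{0..<length W}"
            "\<lambda>i. (- dot d (W ! i) s) mod int l"])
    have "(\<Sum>i<R. int (x (Inl i)) * vec (Inl i) R) = (\<Sum>i\<in>K. int (x (Inl i)) * int (l * w * k))"
      using KR by (intro sum.mono_neutral_cong_right) (auto simp: vec_def)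
    also have "\<dots> = int (l * w * k) * (int (p ^ a * w) * Z)"
      by (simp add: x_in sum_distrib_left[symmetric] sum_distrib_right[symmetric] Z mult_ac)
    finally have 1: "(\<Sum>i<R. int (x (Inl i)) * vec (Inl i) R) = int (l * w * k) * (int (p ^ a * w) * Z)" .
    have 2: "(\<Sum>j<t. y j * vec (Inr j) R) = int (p ^ a * w * p * k) * (\<Sum>j<t. y j)"
      by (simp add: vec_def mult.commute flip: sum_distrib_right)
    have "int m dvd (\<Sum>b\<in>{..<R} <+> {..<t}. int (x b) * vec b R)"
      using dvd[of R] by (simp add: R_def)
    then have "int m dvd int (l * w * k) * (int (p ^ a * w) * Z) + int (p ^ a * w * p * k) * (\<Sum>j<t. y j)"
      unfolding coord 1 2 .
    \<comment> \<open>Since \<open>m = p * l * (p^a * w * k)\<close>, the two coefficients are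
      \<open>(m/p) * w\<close> and \<open>m/l\<close>.\<close>
    then have "int p * int l * int (p ^ a * w * k) dvd
        int l * int (p ^ a * w * k) * (int w * Z) + int p * int (p ^ a * w * k) * (\<Sum>j<t. y j)"
      by (simp add: m n(1) mult_ac)
    then have pX: "int p dvd Z" and lN: "int l dvd (\<Sum>j<t. y j)"
      using dvd_two_primes[of "int p" "int l" "int (p ^ a * w * k)" "int w" Z "\<Sum>j<t. y j"]
        p l \<open>p \<noteq> l\<close> q0 n(2) by auto
    \<comment> \<open>\<open>Z\<close> is 0 or \<open>l^e\<close>, and \<open>p\<close> excludes the
      latter; by \<open>sep\<close>, \<open>l\<close> divides every block sum below
      \<open>d\<close>.\<close>
    have "\<not> int p dvd int l ^ e"
      using p l \<open>p \<noteq> l\<close> by (metis prime_nat_int_transfer prime_dvd_power of_nat_eq_iff primes_dvd_imp_eq)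
    then have s_dvd: "int l dvd s B" if "B < d" for B
      using pX sep[of s] that unfolding Z_def by (auto split: if_splits)
    have zdvd: "z = 0" if "int l dvd z" "0 \<le> z" "z < int l" for z
      using that by (auto dest: zdvd_imp_le)
    have s0: "s B = 0" if "B < d" for B
      using zdvd[OF s_dvd[OF that]] sle by blast
    \<comment> \<open>Only block \<open>d\<close> is left; its sum is a multiple of \<open>l\<close>
      smaller than \<open>l\<close>.\<close>
    then have "(\<Sum>j<t. y j) = s d" using sumy by simp
    then have "(\<Sum>j<t. y j) = 0" using zdvd lN sle by simp
    then have y0: "y j = 0" if "j < t" for j
      using y that by (subst (asm) sum_nonneg_eq_0_iff) auto
    have "x (Inl i) = 0" if "i \<in> K" for i
    proof -
      have "dot d (W ! \<beta> i) s = 0" by (simp add: dot_def s0)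
      then show ?thesis using x_in[OF that] by simp
    qed
    then show "x b = 0" if "b \<in> {..<R} <+> {..<t}"
      using that x_out y0 by (cases b) (auto simp: y_def)
  qed
  then show ?thesis by (simp add: sum.Plus mult_def comp_def R_def)
qed

text \<open>The classical lower bound: take the \<open>i\<close>-th basis element
  \<open>ns ! i - 1\<close> times; each coordinate sees only its own basis element.\<close>

lemma sum_invariant_factors_less_davenport:
  assumes ns: "is_invariant_factors G ns" and "comm_group G" and "finite (carrier G)"
  shows "(\<Sum>i<length ns. ns ! i - 1) < davenport G"
proof (rule sum_less_davenport[OF assms])
  fix x :: "nat \<Rightarrow> nat" and b
  assume le: "\<And>i. i \<in> {..<length ns} \<Longrightarrow> x i \<le> ns ! i - 1"
    and dvd: "\<And>i. i < length ns \<Longrightarrow>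
      int (ns ! i) dvd (\<Sum>b<length ns. int (x b) * (\<lambda>b c. if c = b then 1 else 0) b i)"
    and b: "b \<in> {..<length ns}"
  have "(\<Sum>c<length ns. int (x c) * (\<lambda>b c. if c = b then 1 else 0) c b)
      = (\<Sum>c<length ns. if b = c then int (x c) else 0)"
    by (intro sum.cong) auto
  then have "int (ns ! b) dvd int (x b)"
    using dvd[of b] b by simp
  moreover have "1 < ns ! b"
    using ns b by (auto simp: is_invariant_factors_def)
  ultimately show "x b = 0" using le[OF b] by (auto dest: dvd_imp_le)
qed simp

section \<open>Group order and separating primes\<close>

lemma order_eq_prod_invariant_factors:
  assumes "is_invariant_factors G ns"
  shows "order G = (\<Prod>i<length ns. ns ! i)"
proof -
  let ?P = "product_group {..<length ns} (\<lambda>i. integer_mod_group (ns ! i))"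
  obtain \<phi> where "\<phi> \<in> iso G ?P"
    using assms by (auto simp: is_invariant_factors_def is_iso_def)
  then have "card (carrier G) = card (carrier ?P)"
    using bij_betw_same_card by (auto simp: iso_def)
  also have "\<dots> = (\<Prod>i<length ns. card (carrier (integer_mod_group (ns ! i))))"
    by (simp add: card_PiE)
  also have "\<dots> = (\<Prod>i<length ns. ns ! i)"
    using assms by (intro prod.cong) (force simp: is_invariant_factors_def carrier_integer_mod_group)+
  finally show ?thesis by (simp add: order_def)
qed

lemma primepow_if_one_prime_divisor:
  fixes n :: nat
  assumes "n > 1" and q: "Factorial_Ring.prime q"
    and only: "\<And>p. Factorial_Ring.prime p \<Longrightarrow> p dvd n \<Longrightarrow> p = q"
  shows "primepow n"
proof -
  obtain w where w: "n = q ^ multiplicity q n * w" "\<not> q dvd w"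
    using multiplicity_decompose'[of n q] assms(1) not_prime_unit[of q] q by (metis not_one_less_zero)
  have "w = 1"
  proof (rule ccontr)
    assume "w \<noteq> 1"
    then obtain p where "Factorial_Ring.prime p" "p dvd w" using prime_factor_nat by blast
    moreover then have "p dvd n" using w(1) by (metis dvd_mult)
    ultimately show False using only w(2) by blast
  qed
  then have "n = q ^ multiplicity q n" using w by simp
  then show ?thesis using assms(1) q
    by (metis gr0I power_0 less_irrefl primepow_prime_power)
qed

text \<open>Supplies the data for \<open>davenport_gain\<close>: \<open>p\<close> divides
  \<open>m / n\<close>, and \<open>l\<close> divides the \<open>p\<close>-free part of
  \<open>n\<close>.\<close>

lemma separating_primes_exist:
  fixes m n :: nat
  assumes n: "1 < n" "n dvd m" "n \<noteq> m" and "m > 0"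
    and two: "\<And>q. \<exists>p. Factorial_Ring.prime p \<and> p dvd m \<and> p \<noteq> q"
  obtains p l a w k where "Factorial_Ring.prime p" "Factorial_Ring.prime l" "p \<noteq> l"
    "n = p ^ a * (l * w)" "\<not> p dvd w" "m = n * (p * k)"
proof -
  obtain c where c: "m = n * c" using n by auto
  then have "c \<noteq> 1" using n by auto
  then obtain q where q: "Factorial_Ring.prime q" "q dvd c" using prime_factor_nat by blast
  \<comment> \<open>If \<open>n\<close> is a power of \<open>q\<close>, some other prime divides \<open>m\<close>, hence \<open>c\<close>, and can serve as \<open>p\<close>.\<close>
  have "\<exists>p l. Factorial_Ring.prime p \<and> Factorial_Ring.prime l \<and> p \<noteq> l \<and> p dvd c \<and> l dvd n"
  proof (cases "\<exists>l. Factorial_Ring.prime l \<and> l dvd n \<and> l \<noteq> q")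
    case True
    then show ?thesis using q by metis
  next
    case False
    have "q dvd n"
      using False n(1) prime_factor_nat[of n] by auto
    obtain p where p: "Factorial_Ring.prime p" "p dvd m" "p \<noteq> q" using two by blast
    then have "p dvd c"
      using False c prime_dvd_mult_iff[of p n c] by blast
    then show ?thesis using p q \<open>q dvd n\<close> by blast
  qed
  then obtain p l where pl: "Factorial_Ring.prime p" "Factorial_Ring.prime l" "p \<noteq> l" "p dvd c" "l dvd n"
    by blast
  obtain k where k: "c = p * k" using pl by auto
  obtain v where v: "n = p ^ multiplicity p n * v" "\<not> p dvd v"
    using multiplicity_decompose'[of n p] n(1) not_prime_unit[of p] pl(1) by (metis not_one_less_zero)
  have "\<not> l dvd p ^ multiplicity p n"
    using pl by (metis prime_dvd_power primes_dvd_imp_eq)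
  then have "l dvd v"
    using v(1) pl prime_dvd_mult_iff[of l "p ^ multiplicity p n" v] by metis
  then obtain w where w: "v = l * w" by auto
  then have "\<not> p dvd w" using v(2) by auto
  then show thesis using that pl v(1) c k w by metis
qed

subsection \<open>Multiplicity of invariant factors\<close>

text \<open>In a divisor chain each element is at least twice its predecessor, and the smallest is
  at least 2.\<close>

lemma power_card_dvd_chain_le:
  fixes P :: "nat set"
  assumes "finite P" and "\<And>x. x \<in> P \<Longrightarrow> 2 \<le> x"
    and "\<And>x y. x \<in> P \<Longrightarrow> y \<in> P \<Longrightarrow> x dvd y \<or> y dvd x"
    and "P \<noteq> {}"
  shows "2 ^ card P \<le> Max P"
  using assms
proof (induction P rule: finite_linorder_max_induct)
  case (insert b A)
  show ?case
  proof (cases "A = {}")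
    case True
    then show ?thesis using insert.prems(1) by simp
  next
    case False
    have IH: "2 ^ card A \<le> Max A" using insert False by simp
    have M: "Max A \<in> A" using insert.hyps False by simp
    then have less: "Max A < b" using insert.hyps by blast
    have "2 \<le> Max A" using insert.prems(1) M by simp
    then have "Max A dvd b"
      using insert.prems(2)[of "Max A" b] M less by (auto dest: dvd_imp_le)
    then obtain c where c: "b = Max A * c" by auto
    with less have "2 \<le> c" by (cases c; cases "c - 1") auto
    then have "2 * 2 ^ card A \<le> b" using IH unfolding c by (metis mult.commute mult_le_mono)
    moreover have "Max (insert b A) = b"
      using insert.hyps less False by simp
    ultimately show ?thesis using insert.hyps by auto
  qed
qed simp

lemma frequent_proper_factor:
  fixes f :: "nat \<Rightarrow> nat"
  assumes m: "2 < m" and f: "\<And>i. i < R \<Longrightarrow> 2 \<le> f i \<and> f i dvd m"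
    and chain: "\<And>i j. i \<le> j \<Longrightarrow> j < R \<Longrightarrow> f i dvd f j"
    and pos: "(\<Sum>i<R. ln (real m / real (f i))) \<noteq> 0"
  obtains i where "i < R" "f i \<noteq> m"
    "(\<Sum>i<R. ln (real m / real (f i)))
       \<le> real (card {j. j < R \<and> f j = f i}) * (ln (real m / 2))\<^sup>2 / ln 2"
proof -
  define J where "J = {i. i < R \<and> f i \<noteq> m}"
  define P where "P = f ` J"
  define N where "N v = card {j. j < R \<and> f j = v}" for v
  define lam where "lam = ln (real m / 2)"
  have fin: "finite J" "finite P" by (simp_all add: J_def P_def)
  have sumJ: "(\<Sum>i<R. ln (real m / real (f i))) = (\<Sum>i\<in>J. ln (real m / real (f i)))"
    using m by (intro sum.mono_neutral_right) (auto simp: J_def)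
  then have "J \<noteq> {}" using pos by auto
  then have "P \<noteq> {}" by (simp add: P_def)
  have lam: "lam > 0" using m by (simp add: lam_def)
  have P2: "2 \<le> v" "v dvd m" "v \<noteq> m" if "v \<in> P" for v
    using that f by (auto simp: P_def J_def)
  \<comment> \<open>Adjoining \<open>m\<close> to the chain gains a factor 2, so there are at most
    \<open>log 2 (m / 2)\<close> proper values.\<close>
  have "2 ^ card (insert m P) \<le> Max (insert m P)"
  proof (rule power_card_dvd_chain_le)
    fix x y assume "x \<in> insert m P" "y \<in> insert m P"
    then show "x dvd y \<or> y dvd x"
      using P2(2) chain unfolding P_def J_def
      by (auto) (metis nle_le)+
  qed (use fin m P2 in auto)
  moreover have "Max (insert m P) = m"
    using fin m P2(2) by (intro Max_eqI) (auto intro: dvd_imp_le)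
  moreover have "m \<notin> P" using P2(3) by blast
  ultimately have "2 * 2 ^ card P \<le> m" using fin by simp
  then have "2 ^ card P \<le> real m / 2"
    by (simp add: field_simps flip: of_nat_le_iff[where 'a = real])
  then have "ln (2 ^ card P) \<le> lam"
    unfolding lam_def by (intro ln_mono) auto
  then have cardP: "real (card P) \<le> lam / ln 2"
    by (simp add: ln_realpow field_simps)
  have "Max (N ` P) \<in> N ` P" using fin \<open>P \<noteq> {}\<close> by (intro Max_in) auto
  then obtain i where i: "i \<in> J" "N (f i) = Max (N ` P)" by (auto simp: P_def)
  then have Nmax: "N v \<le> N (f i)" if "v \<in> P" for v using fin that by simp
  have "(\<Sum>i\<in>J. ln (real m / real (f i))) = (\<Sum>v\<in>P. \<Sum>j\<in>{j\<in>J. f j = v}. ln (real m / real (f j)))"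
    using fin by (intro sum.group[symmetric]) (auto simp: P_def)
  also have "\<dots> \<le> (\<Sum>v\<in>P. real (N (f i)) * lam)"
  proof (rule sum_mono)
    fix v assume v: "v \<in> P"
    have "(\<Sum>j\<in>{j\<in>J. f j = v}. ln (real m / real (f j))) \<le> (\<Sum>j\<in>{j\<in>J. f j = v}. lam)"
    proof (rule sum_mono)
      fix j assume "j \<in> {j\<in>J. f j = v}"
      then have "2 \<le> f j" using f by (auto simp: J_def)
      then have "real m / real (f j) \<le> real m / 2" by (intro divide_left_mono) auto
      then show "ln (real m / real (f j)) \<le> lam"
        unfolding lam_def using m \<open>2 \<le> f j\<close> by (intro ln_mono) auto
    qed
    also have "\<dots> = real (N v) * lam"
    proof -
      have "{j\<in>J. f j = v} = {j. j < R \<and> f j = v}" using P2(3)[OF v] by (auto simp: J_def)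
      then show ?thesis by (simp add: N_def)
    qed
    also have "\<dots> \<le> real (N (f i)) * lam"
      using Nmax[OF v] lam by (intro mult_right_mono) auto
    finally show "(\<Sum>j\<in>{j\<in>J. f j = v}. ln (real m / real (f j))) \<le> real (N (f i)) * lam" .
  qed
  also have "\<dots> = real (card P) * (real (N (f i)) * lam)" by simp
  also have "\<dots> \<le> (lam / ln 2) * (real (N (f i)) * lam)"
    using cardP lam by (intro mult_right_mono) auto
  also have "\<dots> = real (N (f i)) * lam\<^sup>2 / ln 2" by (simp add: power2_eq_square)
  finally show thesis
    using that[of i] i sumJ by (simp add: J_def N_def lam_def)
qed

text \<open>If \<open>q\<close> were the only prime dividing \<open>m\<close>, it would be the only
  one dividing any invariant factor, hence the order, which would be a prime power.\<close>

lemma prime_divisors_of_exponent: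
  assumes ns: "is_invariant_factors G (ns @ [m])" and "\<not> primepow (order G)"
  shows "\<exists>p. Factorial_Ring.prime p \<and> p dvd m \<and> p \<noteq> q"
proof (rule ccontr)
  assume only: "\<not> ?thesis"
  let ?ms = "ns @ [m]"
  have gt: "1 < ?ms ! i" if "i < length ?ms" for i
    using ns nth_mem[OF that] unfolding is_invariant_factors_def by blast
  have dvd: "?ms ! i dvd m" if "i < length ?ms" for i
    using ns nth_mem[OF that] unfolding is_invariant_factors_def by (auto simp: sorted_wrt_append)
  have "m > 1" using gt[of "length ns"] by simp
  then obtain p where "Factorial_Ring.prime p" "p dvd m" using prime_factor_nat[of m] by auto
  with only have q: "Factorial_Ring.prime q" by blast
  have "order G \<noteq> 0"
    unfolding order_eq_prod_invariant_factors[OF ns] prod_zero_iff[OF finite_lessThan]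
    using gt by (metis lessThan_iff not_one_less_zero)
  moreover have "m dvd order G"
    unfolding order_eq_prod_invariant_factors[OF ns] by simp
  ultimately have "order G > 1" using \<open>m > 1\<close> dvd_imp_le[of m "order G"] by simp
  moreover have "p = q" if p: "Factorial_Ring.prime p" "p dvd order G" for p
  proof -
    obtain i where "i < length ?ms" "p dvd ?ms ! i"
      using p(2) unfolding order_eq_prod_invariant_factors[OF ns]
        prime_dvd_prod_iff[OF finite_lessThan p(1)] by blast
    then show ?thesis using only p(1) dvd dvd_trans by blast
  qed
  ultimately show False
    using primepow_if_one_prime_divisor q assms(2) by blast
qed

theorem theorem4p6:
  fixes G :: "('a, 'b) monoid_scheme" and r m :: nat
  assumes "comm_group G"
    and "finite (carrier G)"
    and "group_rank G = r" and "1 \<le> r"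
    and "group_exponent G = m" and "2 \<le> m"
    and "\<not> primepow (order G)"
  shows "ereal (real (davenport G)) \<ge>
           ereal (real (davenport_star G)) +
           max (elog2 (ln (real m ^ r / real (order G)))
                  - 2 * elog2 (ln (real m / 2)) - ereal (real m) + elog2 (ln 2) + 1)
               0"
proof -
  have inv: "is_invariant_factors G (invariant_factors G)"
    unfolding invariant_factors_def by (rule someI_ex) (rule invariant_factors_exist[OF assms(1,2)])
  define ns where "ns = butlast (invariant_factors G)"
  \<comment> \<open>Positive rank makes the list nonempty, so its last entry really is
    \<open>m\<close>.\<close>
  have factors: "invariant_factors G = ns @ [m]"
    using assms(3-5) unfolding group_rank_def group_exponent_def ns_def
    by (metis append_butlast_last_id list.size(3) not_one_le_zero)
  have ns: "is_invariant_factors G (ns @ [m])" using inv factors by simp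
  have r: "r = Suc (length ns)" using assms(3) factors by (simp add: group_rank_def)
  have two: "\<exists>p. Factorial_Ring.prime p \<and> p dvd m \<and> p \<noteq> q" for q
    by (rule prime_divisors_of_exponent[OF ns assms(7)])
  have m: "2 < m"
  proof (rule ccontr)
    assume "\<not> 2 < m"
    then have "m = 2" using assms(6) by simp
    then show False using two[of 2] by (auto simp: primes_dvd_imp_eq two_is_prime_nat)
  qed
  have factor: "1 < ns ! i" "ns ! i dvd m" if "i < length ns" for i
    using ns nth_mem[OF that] by (auto simp: is_invariant_factors_def sorted_wrt_append)
  have factor_pos: "0 < ns ! i" if "i < length ns" for i
    using factor(1)[OF that] by simp
  have chain: "ns ! i dvd ns ! j" if "i \<le> j" "j < length ns" for i j
  proof -
    have "sorted_wrt (dvd) ns" using ns by (simp add: is_invariant_factors_def sorted_wrt_append)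
    then show ?thesis using that by (cases "i = j") (auto intro: sorted_wrt_nth_less)
  qed
  have star: "davenport_star G = 1 + (\<Sum>i<length ns. ns ! i - 1) + (m - 1)"
    unfolding davenport_star_def factors
    by (simp add: sum_list_sum_nth atLeast0LessThan nth_append)
  have base: "davenport_star G \<le> davenport G"
    using sum_invariant_factors_less_davenport[OF ns assms(1,2)] unfolding star
    by (simp add: nth_append)
  define lam where "lam = ln (real m / 2)"
  define L where "L = (\<Sum>i<length ns. ln (real m / real (ns ! i)))"
  have lam: "lam > 0" using m by (simp add: lam_def)
  have L: "ln (real m ^ r / real (order G)) = L"
  proof -
    \<comment> \<open>The last factor contributes \<open>m / m = 1\<close>, so \<open>L\<close>
      involves the others only.\<close>
    have "order G = (\<Prod>i<length ns. ns ! i) * m"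
      unfolding order_eq_prod_invariant_factors[OF ns] by (simp add: nth_append)
    then have "real m ^ r / real (order G) = (\<Prod>i<length ns. real m / real (ns ! i))"
      using m by (simp add: r prod_dividef)
    also have "ln \<dots> = L"
      unfolding L_def using factor_pos m by (subst ln_prod) auto
    finally show ?thesis .
  qed
  have L0: "L \<ge> 0"
    unfolding L_def
  proof (intro sum_nonneg)
    fix i assume "i \<in> {..<length ns}"
    then have "ns ! i \<le> m" "ns ! i > 0" using factor(2)[of i] factor_pos m by (auto intro: dvd_imp_le)
    then show "0 \<le> ln (real m / real (ns ! i))" by simp
  qed
  have elog2_fin: "elog2 lam = ereal (log 2 lam)" "elog2 (ln 2) = ereal (log 2 (ln 2))"
    using lam by (simp_all add: elog2_def)
  have two_ereal: "2 = ereal 2" by simp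
  let ?E = "elog2 L - 2 * elog2 lam - ereal (real m) + elog2 (ln 2) + 1"
  have "ereal (real (davenport_star G)) + ?E \<le> ereal (real (davenport G))"
  proof (cases "L = 0")
    case True
    \<comment> \<open>This is the case \<open>|G| = m^r\<close> of the convention.\<close>
    then have E: "?E = - \<infinity>"
      unfolding elog2_fin two_ereal by (simp add: elog2_def one_ereal_def)
    show ?thesis unfolding E by simp
  next
    case False
    obtain i where i: "i < length ns" "ns ! i \<noteq> m"
      and Lle: "L \<le> real (card {j. j < length ns \<and> ns ! j = ns ! i}) * lam\<^sup>2 / ln 2"
      unfolding L_def lam_def
    proof (rule frequent_proper_factor[of m "length ns" "\<lambda>i. ns ! i"])
      show "2 \<le> ns ! i \<and> ns ! i dvd m" if "i < length ns" for i using factor[OF that] by simp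
    qed (use m chain False in \<open>auto simp: L_def\<close>)
    define n where "n = ns ! i"
    define N where "N = card {j. j < length ns \<and> ns ! j = n}"
    have "N \<ge> 1"
      unfolding N_def using i by (auto simp: n_def Suc_le_eq card_gt_0_iff)
    \<comment> \<open>With \<open>2^t\<close> copies, \<open>davenport_gain\<close> admits
      \<open>t + 1\<close> additional terms, while \<open>N < 2^(t + 1)\<close> gives
      \<open>log 2 N \<le> t + 1\<close>.\<close>
    then obtain t where t: "2 ^ t \<le> N" "N < 2 ^ (t + 1)"
      using ex_power_ivl1[of 2 N] by auto
    obtain p l a w k where plawk: "Factorial_Ring.prime p" "Factorial_Ring.prime l" "p \<noteq> l"
      "n = p ^ a * (l * w)" "\<not> p dvd w" "m = n * (p * k)"
      using separating_primes_exist[OF _ _ _ _ two, of n] factor[OF i(1)] i(2) m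
      unfolding n_def by (metis less_trans zero_less_numeral)
    have "(\<Sum>i<length ns. ns ! i - 1) + Suc t < davenport G"
      using davenport_gain[OF ns assms(1,2) plawk, of "Suc t"] t(1) by (simp add: N_def)
    \<comment> \<open>\<open>davenport_star G\<close> is the sum over \<open>ns\<close> plus
      \<open>m\<close>; strictness of the previous inequality yields the final 1.\<close>
    then have "davenport_star G + Suc t + 1 \<le> davenport G + m"
      using m unfolding star by linarith
    then have "real (davenport_star G + Suc t + 1) \<le> real (davenport G + m)"
      by (simp only: of_nat_le_iff)
    then have D: "real (davenport_star G) + real (Suc t) - real m + 1 \<le> real (davenport G)"
      by simp
    have "log 2 L \<le> log 2 (real N * lam\<^sup>2 / ln 2)"
      using Lle L0 False by (simp add: n_def N_def)
    also have "\<dots> = log 2 (real N) + 2 * log 2 lam - log 2 (ln 2)"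
      using \<open>N \<ge> 1\<close> lam by (simp add: log_divide log_mult log_nat_power)
    finally have "log 2 L \<le> log 2 (real N) + 2 * log 2 lam - log 2 (ln 2)" .
    moreover have "log 2 (real N) \<le> real (Suc t)"
      using t(2) \<open>N \<ge> 1\<close> by (intro log2_of_power_le) auto
    ultimately have "real (davenport_star G) +
        (log 2 L - 2 * log 2 lam - real m + log 2 (ln 2) + 1) \<le> real (davenport G)"
      using D by linarith
    moreover have E: "?E = ereal (log 2 L - 2 * log 2 lam - real m + log 2 (ln 2) + 1)"
      using False unfolding elog2_fin two_ereal by (simp add: elog2_def one_ereal_def)
    ultimately show ?thesis unfolding E by simp
  qed
  moreover have "ereal (real (davenport_star G)) + 0 \<le> ereal (real (davenport G))"
    using base by simp
  ultimately show ?thesis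
    unfolding L lam_def[symmetric] by (simp add: max_def)
qed

end
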